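(* For all integers $n\ge 1$ and $k$ with $0\le 2k\le n$, the polynomial $F_{2^k1^{n-2k}}(z)$ is log-concave. In other words, for every involution $\pi\in\mathfrak{S}_n$ (i.e. $\pi^2=\mathrm{id}$, fixed points allowed), the polynomial $F_\pi(z)$ is log-concave.
   Context: For a positive integer $m$, $\mathfrak{S}_m$ is the symmetric group on $\{1,\dots,m\}$, $Q_m\subseteq\mathfrak{S}_m$ is the set of $m$-cycles, and $c(\eta)$ denotes the number of cycles (including fixed points) of a permutation $\eta$. Permutations are multiplied from left to right. For $\pi\in\mathfrak{S}_m$ the IO-polynomial is \[ F_\pi(z)=\sum_{\zeta\in Q_m} z^{\lfloor (c(\zeta\pi)-1)/2\rfloor}. \] A permutation has type $\lambda$ (a partition of $m$) if the multiset of its cycle lengths is $\lambda$; $F_\pi$ depends only on the type of $\pi$, and $F_\lambda:=F_\pi$ for $\pi$ of type $\lambda$. The partition $2^k1^{n-2k}$ has $k$ parts equal to $2$ and $n-2k$ parts equal to $1$. A polynomial $\sum_k a_kz^k$ with nonnegative coefficients is log-concave if $a_k^2\ge a_{k-1}a_{k+1}$ for all $k$. *)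

theory Defs
  imports
    "HOL-Combinatorics.Combinatorics"
    "HOL-Combinatorics.Orbits"
    "HOL-Computational_Algebra.Polynomial"
    "HOL-Library.Multiset"
begin

text \<open>
  Elements of the symmetric group on \<open>{1..m}\<close> are functions \<open>p\<close> with \<open>p permutes {1..m}\<close>.
  The cycles of such a \<open>p\<close> are identified with its orbits on \<open>{1..m}\<close>, singletons included.
\<close>

definition perm_cycles :: "nat \<Rightarrow> (nat \<Rightarrow> nat) \<Rightarrow> nat set set"
  where "perm_cycles m p = Orbits.orbit p ` {1..m}"

definition num_cycles :: "nat \<Rightarrow> (nat \<Rightarrow> nat) \<Rightarrow> nat"
  where "num_cycles m p = card (perm_cycles m p)"

definition cycle_type :: "nat \<Rightarrow> (nat \<Rightarrow> nat) \<Rightarrow> nat multiset"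
  where "cycle_type m p = image_mset card (mset_set (perm_cycles m p))"

definition full_cycles :: "nat \<Rightarrow> (nat \<Rightarrow> nat) set"
  where "full_cycles m = {\<zeta>. \<zeta> permutes {1..m} \<and> cyclic_on \<zeta> {1..m}}"

text \<open>
  Permutations are multiplied from left to right, so the product \<open>\<zeta>\<pi>\<close> is the function \<open>\<pi> \<circ> \<zeta>\<close>.
  For \<open>m \<ge> 1\<close> there is at least one cycle, so the subtraction does not truncate.
\<close>

definition IO_poly :: "nat \<Rightarrow> (nat \<Rightarrow> nat) \<Rightarrow> int poly"
  where "IO_poly m \<pi> = (\<Sum>\<zeta>\<in>full_cycles m. monom 1 ((num_cycles m (\<pi> \<circ> \<zeta>) - 1) div 2))"

text \<open>
  A partition is the multiset of its (positive) parts. The choice of a permutation of type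
  \<open>\<lambda>\<close> is immaterial: permutations of equal type are conjugate and \<open>full_cycles m\<close> is closed
  under conjugation.
\<close>

definition IO_poly_type :: "nat multiset \<Rightarrow> int poly"
  where "IO_poly_type lam =
    (let m = sum_mset lam in IO_poly m (SOME \<pi>. \<pi> permutes {1..m} \<and> cycle_type m \<pi> = lam))"

text \<open>At index \<open>0\<close> the inequality \<open>a\<^sub>k\<^sup>2 \<ge> a\<^sub>k\<^sub>-\<^sub>1 a\<^sub>k\<^sub>+\<^sub>1\<close> is trivial, as \<open>a\<^sub>-\<^sub>1 = 0\<close>.\<close>

definition log_concave_poly :: "'a :: linordered_idom poly \<Rightarrow> bool"
  where "log_concave_poly p \<longleftrightarrow>
    (\<forall>k. 0 \<le> coeff p k) \<and>
    (\<forall>k\<ge>1. coeff p (k - 1) * coeff p (k + 1) \<le> (coeff p k)\<^sup>2)"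

end

theory Submission
  imports Defs
begin

text \<open>
  Write \<open>c(p|S)\<close> for the number of cycles of \<open>p\<close> on a \<open>p\<close>-stable set \<open>S\<close> and fix a point
  \<open>x\<^sub>0\<close>. The indicator of \<open>\<zeta>\<close> being a full cycle is the sum of \<open>(-1)\<close> to the power \<open>c(\<zeta>|S)\<close> over
  all \<open>\<zeta>\<close>-stable \<open>S\<close> avoiding \<open>x\<^sub>0\<close>. Insert this into the sum of \<open>q\<close> to the power \<open>c(\<pi>\<zeta>)\<close> over
  full cycles \<open>\<zeta>\<close>, substitute \<open>\<zeta> = \<pi>\<sigma>\<close> and fix \<open>S\<close>: the contributions cancel as soon as two
  points of \<open>S\<close> have their \<open>\<pi>\<close>-image outside \<open>S\<close>, and otherwise \<open>\<sigma>\<close> is, up to one transposition,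
  an arbitrary pair of permutations of \<open>S\<close> and of its complement, which yields a product of two
  Pochhammer symbols. For an involution \<open>\<pi>\<close> with \<open>k\<close> transpositions the remaining alternating sum
  over \<open>S\<close> is a finite difference, equal to \<open>(n-1)!\<close> times a polynomial \<open>d\<^sub>k(q)\<close> with
  \<open>(k+1) d\<^sub>k = 2q d\<^sub>k\<^sub>-\<^sub>1 + (k-1) d\<^sub>k\<^sub>-\<^sub>2\<close>.
  Under this recurrence the ratios of successive coefficients of \<open>d\<^sub>k\<^sub>-\<^sub>1\<close> and \<open>d\<^sub>k\<close> interlace, which gives log-concavity.
\<close>

section \<open>Harer--Zagier polynomials\<close>

text \<open>
  With the backward shift \<open>E\<close>, \<open>bsum b N\<close> is \<open>(1 + E)\<^sup>b\<close> applied to the binomial coefficient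
  \<open>q(q+1)\<dots>(q+N-1)/N!\<close>.
\<close>

fun bsum :: "nat \<Rightarrow> nat \<Rightarrow> real \<Rightarrow> real" where
  "bsum 0 N q = pochhammer q N / fact N"
| "bsum (Suc b) N q = bsum b N q + bsum b N (q - 1)"

text \<open>Pascal's rule: on binomial coefficients \<open>1 - E\<close> lowers the index
  \<open>N\<close> by one, and it commutes with \<open>1 + E\<close>.\<close>

lemma bsum_diff: "bsum b (Suc N) q - bsum b (Suc N) (q - 1) = bsum b N q"
proof (induction b arbitrary: q)
  case 0
  have "pochhammer q (Suc N) - pochhammer (q - 1) (Suc N) = of_nat (Suc N) * pochhammer q N"
    using pochhammer_rec[of "q - 1" N] by (simp add: pochhammer_rec' algebra_simps)
  then show ?case
    by (simp add: diff_divide_distrib[symmetric])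
next
  case (Suc b)
  from Suc[of q] Suc[of "q - 1"] show ?case by simp
qed

text \<open>Absorption for binomial coefficients, carried through \<open>b\<close> factors
  \<open>1 + E\<close>; moving multiplication by \<open>q\<close> past each factor leaves one
  correction term. At \<open>b = 0\<close> the truncated \<open>b - 1\<close> is multiplied by
  0.\<close>

lemma bsum_mult:
  "real (Suc N) * bsum b (Suc N) q = (q + N) * bsum b N q - b * bsum (b - 1) N (q - 1)"
proof (induction b arbitrary: q)
  case 0
  show ?case by (simp add: pochhammer_rec')
next
  case (Suc b)
  have "real b * bsum b N (q - 1) = b * bsum (b - 1) N (q - 1) + b * bsum (b - 1) N (q - 2)"
    by (cases b) (auto simp: algebra_simps)
  with Suc[of q] Suc[of "q - 1"] show ?case by (simp add: algebra_simps)
qed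

text \<open>Up to normalisation these are the Harer--Zagier polynomials counting one-face maps with \<open>k\<close> edges by vertices.\<close>

definition hz :: "nat \<Rightarrow> real \<Rightarrow> real" where "hz k = bsum k (Suc k)"

lemma hz_0: "hz 0 q = q"
  by (simp add: hz_def)

lemma hz_diff: "hz (Suc k) q - hz (Suc k) (q - 1) = hz k q + hz k (q - 1)"
  using bsum_diff[of "Suc k" "Suc k" q] by (simp add: hz_def)

lemma hz_mult: "real (k + 2) * hz (Suc k) q = q * (hz k q + hz k (q - 1)) + (k + 1) * hz k q"
  using bsum_mult[of "Suc k" "Suc k" q] by (simp add: hz_def algebra_simps)

lemma hz_mult_forward:
  "real (k + 2) * hz (Suc k) q = q * (hz k (q + 1) + hz k q) - (k + 1) * hz k q"
proof -
  have "hz (Suc k) (q + 1) - hz (Suc k) q = hz k (q + 1) + hz k q"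
    using hz_diff[of k "q + 1"] by simp
  then have "real (k + 2) * hz (Suc k) q
      = real (k + 2) * hz (Suc k) (q + 1) - real (k + 2) * (hz k (q + 1) + hz k q)"
    by (simp add: algebra_simps)
  then show ?thesis
    using hz_mult[of k "q + 1"] by (simp add: algebra_simps)
qed

lemma hz_1: "hz 1 q = q\<^sup>2"
  using hz_mult[of 0 q] by (simp add: hz_0 power2_eq_square algebra_simps)

text \<open>Eliminating \<open>hz k (q - 1)\<close> between the multiplication rule and the
  difference rule leaves a recurrence at a single argument.\<close>

lemma hz_rec: "real (k + 3) * hz (k + 2) q = 2 * q * hz (k + 1) q + (k + 1) * hz k q"
proof -
  have "real (k + 3) * hz (k + 2) q
      = q * (2 * hz (k + 1) q - (hz k q + hz k (q - 1))) + (k + 2) * hz (k + 1) q"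
    using hz_mult[of "Suc k" q] hz_diff[of k q] by (simp add: algebra_simps)
  then show ?thesis
    using hz_mult[of k q] by (simp add: algebra_simps)
qed

text \<open>The operator identity 2 = (1 + E) + (1 - E).\<close>

lemma two_bsum: "2 * bsum b (Suc N) q = bsum (Suc b) (Suc N) q + bsum b N q"
  using bsum_diff[of b N q] by simp

text \<open>The left side is what the sum over \<open>S\<close> yields for an involution with a
  fixed point: the first term comes from stable sets, the second from the \<open>2 * k\<close> moved
  points that can be added to one.\<close>

lemma hz_fixed_point_case:
  "q * bsum k k (q + 1) - 2 * k * bsum (k - 1) (k + 1) q = hz k q"
proof (cases k)
  case 0
  then show ?thesis by (simp add: hz_0)
next
  case (Suc l)
  have "2 * bsum l (l + 2) q = hz (l + 1) q + hz l q"
    using two_bsum[of l "Suc l" q] by (simp add: hz_def)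
  then have "2 * k * bsum l (l + 2) q = (l + 1) * hz (l + 1) q + (l + 1) * hz l q"
    by (simp add: Suc algebra_simps)
  moreover have "bsum k k (q + 1) = hz l (q + 1) + hz l q"
    by (simp add: Suc hz_def)
  ultimately show ?thesis
    using hz_mult_forward[of l q] by (simp add: Suc algebra_simps)
qed

text \<open>The analogue without fixed points: stable sets, stable sets with the image of the base
  point added, and stable sets with one of the other \<open>2 * (k - 1)\<close> points added. At
  \<open>k = 1\<close> the truncated \<open>k - 2\<close> is multiplied by 0.\<close>

lemma hz_no_fixed_point_case:
  assumes "k \<ge> 1"
  shows "q * bsum (k - 1) k (q + 1) - bsum (k - 1) k q - 2 * (k - 1) * bsum (k - 2) (k + 1) q
      = hz k q"
proof -
  consider "k = 1" | l where "k = l + 2"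
    using assms by (metis add.commute le_neq_implies_less less_iff_Suc_add add_2_eq_Suc
        Suc_eq_plus1 One_nat_def)
  then show ?thesis
  proof cases
    case 1
    then show ?thesis using hz_1[of q] by (simp add: power2_eq_square algebra_simps)
  next
    case 2
    \<comment> \<open>The identity 2 = (1 + E) + (1 - E) is applied twice.\<close>
    have "4 * bsum l (l + 3) q = hz (l + 2) q + 2 * hz (l + 1) q + hz l q"
      using two_bsum[of l "Suc (Suc l)" q] two_bsum[of "Suc l" "Suc (Suc l)" q] two_bsum[of l "Suc
          l" q]
      by (simp add: hz_def eval_nat_numeral)
    then have "4 * (k - 1) * bsum l (l + 3) q
        = (l + 1) * (hz (l + 2) q + 2 * hz (l + 1) q + hz l q)"
      by (simp add: 2 algebra_simps)
    moreover have "bsum (k - 1) k = hz (l + 1)"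
      by (simp add: 2 hz_def)
    ultimately show ?thesis
      using hz_mult_forward[of "l + 1" q] hz_rec[of l q]
          by (simp add: 2 algebra_simps eval_nat_numeral)
  qed
qed

section \<open>Coefficients of the Harer--Zagier polynomials\<close>

text \<open>\<open>hz_coeff k j\<close> is the coefficient of \<open>q ^ (k + 1 - 2 * j)\<close> in
  \<open>hz k\<close>. The recurrence for \<open>hz\<close> preserves the parity of exponents, so
  \<open>j\<close> counts steps of two down from the top degree.\<close>

fun hz_coeff :: "nat \<Rightarrow> nat \<Rightarrow> real" where
  "hz_coeff 0 j = (if j = 0 then 1 else 0)"
| "hz_coeff (Suc 0) j = (if j = 0 then 1 else 0)"
| "hz_coeff (Suc (Suc k)) j =
     (2 * hz_coeff (Suc k) j + (k + 1) * (case j of 0 \<Rightarrow> 0 | Suc i \<Rightarrow> hz_coeff k i)) / (k + 3)"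

lemma hz_coeff_eq_0: "k < 2 * j \<Longrightarrow> hz_coeff k j = 0"
  by (induction k j rule: hz_coeff.induct) (auto split: nat.splits)

lemma hz_coeff_nonneg: "0 \<le> hz_coeff k j"
  by (induction k j rule: hz_coeff.induct) (auto split: nat.splits)

lemma hz_coeff_pos: "2 * j \<le> k \<Longrightarrow> 0 < hz_coeff k j"
proof (induction k j rule: hz_coeff.induct)
  case (3 k j)
  show ?case
  proof (cases j)
    case 0
    with 3 show ?thesis by simp
  next
    case (Suc i)
    with 3 have "0 < hz_coeff k i" by simp
    then show ?thesis
      using hz_coeff_nonneg[of "Suc k" j] by (simp add: Suc add_nonneg_pos)
  qed
qed auto

text \<open>The bound \<open>M\<close> stays free because the step to \<open>k + 2\<close> needs the
  same \<open>M\<close> for \<open>k + 1\<close> and \<open>M - 1\<close> for \<open>k\<close>.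
  Surplus terms have coefficient 0, which makes the truncated exponents harmless.\<close>

lemma hz_eq_sum:
  "k \<le> 2 * M + 1 \<Longrightarrow> hz k q = (\<Sum>j\<le>M. hz_coeff k j * q ^ (k + 1 - 2 * j))"
proof (induction k arbitrary: M rule: induct_nat_012)
  case 0
  have "(\<Sum>j\<le>M. hz_coeff 0 j * q ^ (0 + 1 - 2 * j)) = (\<Sum>j\<le>M. if j = 0 then q else 0)"
    by (intro sum.cong) auto
  then show ?case by (simp add: hz_0)
next
  case 1
  have "(\<Sum>j\<le>M. hz_coeff (Suc 0) j * q ^ (Suc 0 + 1 - 2 * j)) = (\<Sum>j\<le>M. if j = 0 then q\<^sup>2 else 0)"
    by (intro sum.cong) (auto simp: power2_eq_square)
  then show ?case using hz_1[of q] by simp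
next
  case (ge2 k)
  from ge2.prems obtain M' where M: "M = Suc M'" by (cases M) auto
  have rec: "real (k + 3) * hz_coeff (k + 2) j
      = 2 * hz_coeff (k + 1) j + (k + 1) * (case j of 0 \<Rightarrow> 0 | Suc i \<Rightarrow> hz_coeff k i)" for j
    by simp
  have "real (k + 3) * (\<Sum>j\<le>M. hz_coeff (k + 2) j * q ^ (k + 3 - 2 * j))
      = (\<Sum>j\<le>M. 2 * hz_coeff (k + 1) j * q ^ (k + 3 - 2 * j)
          + (k + 1) * ((case j of 0 \<Rightarrow> 0 | Suc i \<Rightarrow> hz_coeff k i) * q ^ (k + 3 - 2 * j)))"
    unfolding sum_distrib_left mult.assoc[symmetric] rec by (simp add: algebra_simps)
  also have "\<dots> = (\<Sum>j\<le>M. 2 * q * (hz_coeff (k + 1) j * q ^ (k + 2 - 2 * j)))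
      + (k + 1) * (\<Sum>j\<le>M. (case j of 0 \<Rightarrow> 0 | Suc i \<Rightarrow> hz_coeff k i) * q ^ (k + 3 - 2 * j))"
  proof -
    have "2 * hz_coeff (k + 1) j * q ^ (k + 3 - 2 * j)
        = 2 * q * (hz_coeff (k + 1) j * q ^ (k + 2 - 2 * j))" for j
    proof (cases "2 * j \<le> k + 1")
      case True
      then have "k + 3 - 2 * j = Suc (k + 2 - 2 * j)" by simp
      then show ?thesis by simp
    qed (simp add: hz_coeff_eq_0)
    then show ?thesis unfolding sum.distrib sum_distrib_left by (simp only:)
  qed
  also have "(\<Sum>j\<le>M. (case j of 0 \<Rightarrow> 0 | Suc i \<Rightarrow> hz_coeff k i) * q ^ (k + 3 - 2 * j))
      = (\<Sum>j\<le>M'. hz_coeff k j * q ^ (k + 1 - 2 * j))"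
    unfolding M by (simp add: sum.atMost_Suc_shift del: sum.atMost_Suc)
  also have "\<dots> = hz k q"
    using ge2.prems M by (intro ge2.IH(1)[symmetric]) simp
  also have "(\<Sum>j\<le>M. 2 * q * (hz_coeff (k + 1) j * q ^ (k + 2 - 2 * j))) = 2 * q * hz (k + 1) q"
    using ge2.IH(2)[of M] ge2.prems by (simp add: sum_distrib_left)
  also have "2 * q * hz (k + 1) q + (k + 1) * hz k q = real (k + 3) * hz (k + 2) q"
    using hz_rec[of k q] by simp
  finally show ?case by (simp add: numeral_3_eq_3 del: hz_coeff.simps of_nat_Suc)
qed

text \<open>
  The successive ratios of \<open>hz_coeff k\<close> and \<open>hz_coeff (Suc k)\<close> interlace, and the recurrence
  replaces a ratio by a mediant of two neighbouring ones.
\<close>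

lemma hz_coeff_interlacing:
  "hz_coeff (Suc k) j * hz_coeff k (Suc j) \<le> hz_coeff (Suc k) (Suc j) * hz_coeff k j
   \<and> hz_coeff (Suc k) (Suc (Suc j)) * hz_coeff k j \<le> hz_coeff (Suc k) (Suc j) * hz_coeff k (Suc j)
   \<and> hz_coeff (Suc k) (Suc (Suc j)) * hz_coeff (Suc k) j \<le> (hz_coeff (Suc k) (Suc j))\<^sup>2"
proof (induction k arbitrary: j)
  case 0
  show ?case by simp
next
  case (Suc k)
  define f where "f = hz_coeff (Suc k)"
  define g where "g = hz_coeff k"
  define h where "h = hz_coeff (Suc (Suc k))"
  define a where "a = 2 / real (k + 3)"
  define b where "b = real (k + 1) / real (k + 3)"
  have ab: "a \<ge> 0" "b \<ge> 0" by (auto simp: a_def b_def)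
  have nonneg: "f i \<ge> 0" "g i \<ge> 0" "h i \<ge> 0" for i
    unfolding f_def g_def h_def by (rule hz_coeff_nonneg)+
  have h: "h i = a * f i + b * (case i of 0 \<Rightarrow> 0 | Suc i \<Rightarrow> g i)" for i
    by (cases i) (simp_all add: h_def a_def b_def f_def g_def add_divide_distrib add_ac
        ring_distribs)
  have IH: "f i * g (Suc i) \<le> f (Suc i) * g i" "f (Suc (Suc i)) * g i \<le> f (Suc i) * g (Suc i)"
    "f (Suc (Suc i)) * f i \<le> (f (Suc i))\<^sup>2" for i
    using Suc.IH[of i] by (auto simp: f_def g_def)
  \<comment> \<open>The multiples of \<open>a\<close> on both sides agree; comparing the multiples
    of \<open>b\<close> is the second induction hypothesis at \<open>j - 1\<close>.\<close>
  have 1: "h j * f (Suc j) \<le> h (Suc j) * f j"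
  proof (cases j)
    case 0
    have "0 \<le> b * (g 0 * f 0)" using ab nonneg by simp
    then show ?thesis by (simp add: h 0 algebra_simps)
  next
    case [simp]: (Suc i)
    have "b * (f (Suc (Suc i)) * g i) \<le> b * (f (Suc i) * g (Suc i))"
      using ab IH by (intro mult_left_mono) auto
    then show ?thesis by (simp add: h algebra_simps)
  qed
  \<comment> \<open>Here log-concavity of \<open>f\<close> bounds the \<open>a\<close> part and the
    first interlacing inequality bounds the \<open>b\<close> part.\<close>
  have "a * (f (Suc (Suc j)) * f j) \<le> a * (f (Suc j))\<^sup>2" "b * (f j * g (Suc j))
      \<le> b * (f (Suc j) * g j)"
    using ab IH by (auto intro!: mult_left_mono)
  then have 2: "h (Suc (Suc j)) * f j \<le> h (Suc j) * f (Suc j)"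
    by (simp add: h algebra_simps power2_eq_square)
  \<comment> \<open>The product of the two new interlacing inequalities contains the factor
    \<open>f j * f (Suc j)\<close> on both sides. Where that factor is not known to be positive,
    \<open>h (Suc (Suc j))\<close> lies beyond the last nonzero coefficient.\<close>
  have 3: "h (Suc (Suc j)) * h j \<le> (h (Suc j))\<^sup>2"
  proof (cases "2 * j + 2 \<le> k + 1")
    case True
    then have pos: "f j * f (Suc j) > 0"
      by (simp add: f_def hz_coeff_pos)
    have "(h (Suc (Suc j)) * f j) * (h j * f (Suc j)) \<le> (h (Suc j) * f (Suc j)) * (h (Suc j) * f j)"
      using nonneg by (intro mult_mono[OF 2 1]) auto
    then have "(h (Suc (Suc j)) * h j) * (f j * f (Suc j)) \<le> (h (Suc j))\<^sup>2 * (f j * f (Suc j))"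
      by (simp add: power2_eq_square mult_ac)
    with pos show ?thesis by (simp only: mult_le_cancel_right_pos)
  next
    case False
    then have "h (Suc (Suc j)) = 0"
      unfolding h_def by (intro hz_coeff_eq_0) simp
    then show ?thesis by simp
  qed
  from 1 2 3 show ?case by (simp add: f_def h_def)
qed

lemma hz_coeff_log_concave:
  "hz_coeff k (Suc (Suc j)) * hz_coeff k j \<le> (hz_coeff k (Suc j))\<^sup>2"
  using hz_coeff_interlacing[of "k - 1" j] by (cases k) auto

section \<open>Counting cycles of permutations\<close>

hide_const (open) Perm.orbit

text \<open>\<open>S\<close> may be smaller than the set permuted by \<open>p\<close>: for stable
  \<open>S\<close> this counts the cycles of the restriction to \<open>S\<close>.\<close>

definition cycle_count :: "('a \<Rightarrow> 'a) \<Rightarrow> 'a set \<Rightarrow> nat" where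
  "cycle_count p S = card (orbit p ` S)"

lemma orbit_self: "finite X \<Longrightarrow> p permutes X \<Longrightarrow> x \<in> orbit p x"
  by (simp add: permutation_self_in_orbit permutes_imp_permutation)

lemma orbit_eq: "finite X \<Longrightarrow> p permutes X \<Longrightarrow> y \<in> orbit p x \<Longrightarrow> orbit p y = orbit p x"
  by (meson cyclic_on_orbit orbit_cyclic_eq3)

lemma orbit_stable_subset: "p ` S \<subseteq> S \<Longrightarrow> x \<in> S \<Longrightarrow> orbit p x \<subseteq> S"
proof
  fix y assume "p ` S \<subseteq> S" "x \<in> S" "y \<in> orbit p x"
  from this(3,1,2) show "y \<in> S" by induction auto
qed

lemma cycle_count_cong:
  assumes "p ` S \<subseteq> S" "\<And>x. x \<in> S \<Longrightarrow> p x = r x"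
  shows "cycle_count p S = cycle_count r S"
proof -
  have "orbit p x = orbit r x" if "x \<in> S" for x
    using that assms by (intro orbit_cong0[of x S]) auto
  then show ?thesis by (simp add: cycle_count_def cong: image_cong)
qed

lemma cycle_count_Un:
  assumes "finite S" "finite T" "p ` S \<subseteq> S" "p ` T \<subseteq> T" "S \<inter> T = {}"
  shows "cycle_count p (S \<union> T) = cycle_count p S + cycle_count p T"
proof -
  have "orbit p x \<noteq> orbit p y" if "x \<in> S" "y \<in> T" for x y
    using orbit_stable_subset[of p S x] orbit_stable_subset[of p T y] that assms orbit_nonempty[of
        p x]
    by blast
  then have "orbit p ` S \<inter> orbit p ` T = {}" by blast
  then show ?thesis
    using assms by (simp add: cycle_count_def image_Un card_Un_disjoint)
qed

lemma cycle_count_inv: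
  "finite X \<Longrightarrow> p permutes X \<Longrightarrow> cycle_count (inv p) S = cycle_count p S"
  by (simp add: cycle_count_def orbit_inv_eq permutes_imp_permutation)

lemma cycle_count_conjugate:
  assumes "finite X" "p permutes X" "t permutes X"
  shows "cycle_count (t \<circ> p \<circ> inv t) X = cycle_count p X"
proof -
  have "orbit (t \<circ> p \<circ> inv t) (t x) = t ` orbit p x" for x
    using assms by (intro orbit_inverse[symmetric]) (auto simp: orbit_self permutes_inverses)
  then have "orbit (t \<circ> p \<circ> inv t) ` (t ` X) = (`) t ` (orbit p ` X)"
    unfolding image_image by simp
  moreover have "inj_on ((`) t) (orbit p ` X)"
    using permutes_inj[OF assms(3)] by (auto simp: inj_on_def inj_image_eq_iff)
  ultimately show ?thesis
    unfolding cycle_count_def using assms(3) by (metis card_image permutes_image)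
qed

section \<open>Multiplication by a transposition and the number of cycles\<close>

text \<open>The transposition joins two different cycles into one and leaves all others as they
  are.\<close>

lemma cycle_count_comp_transpose:
  assumes X: "finite X" "p permutes X" and xy: "x \<in> X" "y \<in> X" "y \<notin> orbit p x"
  shows "Suc (cycle_count (p \<circ> transpose x y) X) = cycle_count p X"
proof -
  let ?t = "transpose x y" and ?O = "orbit p x \<union> orbit p y"
  note self = orbit_self[OF X] and eq = orbit_eq[OF X]
  have disj: "orbit p x \<inter> orbit p y = {}"
    using xy self eq by blast
  have Osub: "?O \<subseteq> X"
    using permutes_orbit_subset[OF X(2)] xy by blast
  have xO: "x \<in> ?O" "y \<in> ?O" using self by auto
  have pt: "p \<circ> ?t permutes X"
    using X xy by (intro permutes_compose permutes_swap_id)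
  \<comment> \<open>From \<open>a\<close> the new map jumps to \<open>p b\<close> and then follows
    the old cycle of \<open>b\<close>, which does not meet \<open>a\<close>, until it reaches
    \<open>b\<close>.\<close>
  have half: "orbit p b \<subseteq> orbit (p \<circ> transpose a b) a"
    if ab: "a \<notin> orbit p b" for a b
  proof
    have pb: "p b \<in> orbit (p \<circ> transpose a b) a"
      using orbit.base[of "p \<circ> transpose a b" a] by (simp only: comp_apply transpose_apply_first)
    fix z assume "z \<in> orbit p b"
    then show "z \<in> orbit (p \<circ> transpose a b) a"
    proof induction
      case base
      show ?case by (rule pb)
    next
      case (step z)
      show ?case
      proof (cases "z = b")
        case True
        then show ?thesis using pb by (simp only:)
      next
        case False
        then have "(p \<circ> transpose a b) z = p z" using step ab by (auto simp: transpose_def)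
        then show ?thesis using orbit.step[OF step.IH] by (simp only:)
      qed
    qed
  qed
  have sub1: "orbit p y \<subseteq> orbit (p \<circ> ?t) x"
    using half[of x y] self disj by blast
  have sub2: "orbit p x \<subseteq> orbit (p \<circ> ?t) y"
    using half[of y x] xy(3) by (simp add: transpose_commute)
  have y_in: "y \<in> orbit (p \<circ> ?t) x" using sub1 self by blast
  have stable: "(p \<circ> ?t) ` ?O \<subseteq> ?O"
    using xO by (auto simp: transpose_def orbit.intros)
  have merged: "orbit (p \<circ> ?t) x = ?O"
  proof
    show "orbit (p \<circ> ?t) x \<subseteq> ?O"
      using stable xO by (intro orbit_stable_subset)
    show "?O \<subseteq> orbit (p \<circ> ?t) x"
      using sub1 sub2 y_in orbit_eq[OF X(1) pt y_in] by simp
  qed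
  have rest: "(p \<circ> ?t) z = p z" if "z \<in> X - ?O" for z
    using that xO by (auto simp: transpose_def)
  have restO: "p ` (X - ?O) \<subseteq> X - ?O"
  proof
    fix w assume "w \<in> p ` (X - ?O)"
    then obtain z where z: "z \<in> X" "z \<notin> ?O" "w = p z" by blast
    have "orbit p w = orbit p z" using eq[OF orbit.base] z by simp
    moreover have "w \<in> X" using z X by (simp add: permutes_in_image)
    ultimately show "w \<in> X - ?O"
      using z self eq by (metis Diff_iff Un_iff)
  qed
  have decomp: "X = (X - ?O) \<union> ?O" using Osub by blast
  have fin: "finite ?O" using Osub X finite_subset by blast
  have "cycle_count (p \<circ> ?t) X = cycle_count (p \<circ> ?t) (X - ?O) + cycle_count (p \<circ> ?t) ?O"
    using X restO rest stable fin by (subst decomp, intro cycle_count_Un) (auto simp: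
        image_subset_iff)
  moreover have "cycle_count p X = cycle_count p (X - ?O) + cycle_count p ?O"
    using X restO fin by (subst decomp, intro cycle_count_Un) (auto simp: image_subset_iff intro:
        orbit.intros)
  moreover have "cycle_count (p \<circ> ?t) (X - ?O) = cycle_count p (X - ?O)"
    using restO rest by (intro cycle_count_cong) auto
  moreover have "cycle_count (p \<circ> ?t) ?O = 1"
  proof -
    have "orbit (p \<circ> ?t) z = ?O" if "z \<in> ?O" for z
      using orbit_eq[OF X(1) pt, of z x] that merged by simp
    then have "orbit (p \<circ> ?t) ` ?O = {?O}" using xO by blast
    then show ?thesis by (simp add: cycle_count_def)
  qed
  moreover have "cycle_count p ?O = 2"
  proof -
    have "orbit p ` ?O = {orbit p x, orbit p y}" using eq self by blast
    moreover have "orbit p x \<noteq> orbit p y" using xy(3) self by blast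
    ultimately show ?thesis by (simp add: cycle_count_def)
  qed
  ultimately show ?thesis by simp
qed

text \<open>Inversion keeps the cycles as sets and turns left multiplication by a transposition into
  right multiplication.\<close>

lemma cycle_count_transpose_comp:
  assumes X: "finite X" "p permutes X" and xy: "x \<in> X" "y \<in> X" "y \<notin> orbit p x"
  shows "Suc (cycle_count (transpose x y \<circ> p) X) = cycle_count p X"
proof -
  have "transpose x y \<circ> p permutes X"
    using X xy by (intro permutes_compose permutes_swap_id)
  then have "cycle_count (transpose x y \<circ> p) X = cycle_count (inv (transpose x y \<circ> p)) X"
    using cycle_count_inv[OF X(1)] by simp
  also have "inv (transpose x y \<circ> p) = inv p \<circ> transpose x y"
    using X by (simp add: o_inv_distrib permutes_bij)
  also have "Suc (cycle_count \<dots> X) = cycle_count (inv p) X"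
    using X xy by (intro cycle_count_comp_transpose) (auto simp: permutes_inv orbit_inv_eq
        permutes_imp_permutation)
  also have "\<dots> = cycle_count p X" by (rule cycle_count_inv[OF X])
  finally show ?thesis .
qed

lemma cycle_count_insert_fixed:
  assumes "finite X" "p permutes X" "a \<notin> X"
  shows "cycle_count p (insert a X) = Suc (cycle_count p X)"
proof -
  have "p a = a" using assms by (simp add: permutes_not_in)
  then have "cycle_count p {a} = 1" by (simp add: cycle_count_def)
  moreover have "cycle_count p ({a} \<union> X) = cycle_count p {a} + cycle_count p X"
    using assms \<open>p a = a\<close> by (intro cycle_count_Un) (auto simp: permutes_in_image)
  ultimately show ?thesis by simp
qed

lemma cycle_count_transpose_insert:
  assumes "finite X" "p permutes X" "a \<notin> X" "b \<in> X"
  shows "cycle_count (transpose a b \<circ> p) (insert a X) = cycle_count p X"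
proof -
  have p: "p permutes insert a X" using assms by (simp add: permutes_imp_permutes_insert)
  have "orbit p a = {a}"
    using assms by (simp add: orbit_eq_singleton_iff permutes_not_in)
  then have "b \<notin> orbit p a" using assms by auto
  then have "Suc (cycle_count (transpose a b \<circ> p) (insert a X)) = cycle_count p (insert a X)"
    using assms p by (intro cycle_count_transpose_comp) auto
  then show ?thesis using cycle_count_insert_fixed[OF assms(1-3)] by simp
qed

section \<open>Generating function of cycle counts, and the sign\<close>

text \<open>A new point is either fixed, which contributes a factor \<open>z\<close>, or spliced
  into a cycle next to one of the \<open>card X\<close> old points, which creates no cycle; so the
  factor is \<open>z + card X\<close>.\<close>

lemma sum_power_cycle_count:
  fixes z :: "'b :: comm_ring_1"
  assumes "finite X"
  shows "(\<Sum>p | p permutes X. z ^ cycle_count p X) = pochhammer z (card X)"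
  using assms
proof (induction X rule: finite_induct)
  case empty
  have "{p :: 'a \<Rightarrow> 'a. p permutes {}} = {id}" by auto
  then show ?case by (simp add: cycle_count_def)
next
  case (insert a X)
  let ?P = "{p. p permutes X}"
  have "(\<Sum>p | p permutes insert a X. z ^ cycle_count p (insert a X))
     = (\<Sum>b\<in>insert a X. \<Sum>p\<in>?P. z ^ cycle_count (transpose a b \<circ> p) (insert a X))"
    by (rule sum_over_permutations_insert[OF insert.hyps(1,2)])
  also have "\<dots> = (\<Sum>p\<in>?P. z ^ cycle_count p (insert a X))
      + (\<Sum>b\<in>X. \<Sum>p\<in>?P. z ^ cycle_count (transpose a b \<circ> p) (insert a X))"
    using insert.hyps by simp
  also have "(\<Sum>p\<in>?P. z ^ cycle_count p (insert a X)) = z * (\<Sum>p\<in>?P. z ^ cycle_count p X)"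
    unfolding sum_distrib_left using insert.hyps
        by (intro sum.cong) (auto simp: cycle_count_insert_fixed)
  also have "(\<Sum>b\<in>X. \<Sum>p\<in>?P. z ^ cycle_count (transpose a b \<circ> p) (insert a X))
      = (\<Sum>b\<in>X. \<Sum>p\<in>?P. z ^ cycle_count p X)"
    using insert.hyps by (intro sum.cong) (auto simp: cycle_count_transpose_insert)
  finally show ?case
    using insert by (simp add: pochhammer_Suc algebra_simps)
qed

text \<open>Splice out a point \<open>a\<close>: if \<open>a\<close> is moved, the cycle count stays
  and the sign flips; if \<open>a\<close> is fixed, cardinality and count both drop by one. The sum
  in the exponent has the parity of the usual difference.\<close>

lemma sign_eq_cycle_count:
  assumes "finite X" "p permutes X"
  shows "sign p = (-1) ^ (card X + cycle_count p X)"
  using assms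
proof (induction X arbitrary: p rule: finite_induct)
  case empty
  then show ?case by (simp add: cycle_count_def)
next
  case (insert a X)
  define r where "r = transpose a (p a) \<circ> p"
  have r: "r permutes X" unfolding r_def by (rule permutes_insert_lemma[OF insert.prems])
  have p: "p = transpose a (p a) \<circ> r" by (simp add: r_def o_assoc fun_eq_iff)
  have IH: "sign r = (-1) ^ (card X + cycle_count r X)" by (rule insert.IH[OF r])
  show ?case
  proof (cases "p a = a")
    case True
    then have "p = r" using p by simp
    then show ?thesis using IH insert.hyps r by (simp add: cycle_count_insert_fixed)
  next
    case False
    have "p a \<in> X" using False insert.prems by (metis insertE insertI1 permutes_in_image)
    then have "cycle_count p (insert a X) = cycle_count r X"
      using p cycle_count_transpose_insert[OF insert.hyps(1) r insert.hyps(2), of "p a"] by simp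
    moreover have "sign p = - sign r"
    proof -
      have "sign (transpose a (p a) \<circ> r) = sign (transpose a (p a)) * sign r"
        using r insert.hyps by (intro sign_compose) (auto intro: permutes_imp_permutation
            permutation_swap_id)
      with p False show ?thesis by (simp add: sign_swap_id)
    qed
    ultimately show ?thesis using IH insert.hyps by simp
  qed
qed

lemma bij_betw_stable: "p permutes X \<Longrightarrow> p ` S = S \<Longrightarrow> bij_betw p S S"
  by (metis bij_betw_def inj_on_subset permutes_inj subset_UNIV)

lemma cycle_count_restrict_id:
  "p ` S \<subseteq> S \<Longrightarrow> cycle_count (restrict_id p S) S = cycle_count p S"
  by (rule cycle_count_cong[symmetric]) auto

lemma sign_on_eq_cycle_count:
  assumes "finite S" "bij_betw p S S"
  shows "sign_on S p = (-1) ^ (card S + cycle_count p S)"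
proof -
  have "p ` S \<subseteq> S" using assms by (auto simp: bij_betw_def)
  then show ?thesis
    using sign_eq_cycle_count[OF assms(1) permutes_restrict_id[OF assms(2)]]
    by (simp add: sign_on_def cycle_count_restrict_id)
qed

text \<open>Multiplicativity of the sign on \<open>S\<close>, read as a statement about parities of
  cycle counts.\<close>

lemma neg_one_power_cycle_count_comp:
  assumes "finite S" "bij_betw p S S" "bij_betw r S S"
  shows "(-1) ^ cycle_count (p \<circ> r) S
    = ((-1) ^ (card S + cycle_count p S + cycle_count r S) :: 'b :: comm_ring_1)"
proof -
  have "bij_betw (p \<circ> r) S S" using assms bij_betw_trans by blast
  then have "(-1) ^ (card S + cycle_count (p \<circ> r) S)
      = ((-1) ^ (card S + cycle_count p S) * (-1) ^ (card S + cycle_count r S) :: int)"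
    using sign_on_compose[OF assms(2,3,1)] assms by (simp only: sign_on_eq_cycle_count)
  then have "even (cycle_count (p \<circ> r) S) = even (card S + cycle_count p S + cycle_count r S)"
    by (auto simp: minus_one_power_iff split: if_splits)
  then show ?thesis by (simp add: minus_one_power_iff)
qed

section \<open>Stable subsets\<close>

lemma image_orbit_Union:
  assumes X: "finite X" "p permutes X" and C: "C \<subseteq> orbit p ` T"
  shows "orbit p ` \<Union> C = C"
proof -
  have "orbit p y = c" if "c \<in> C" "y \<in> c" for c y
    using that C orbit_eq[OF X] by blast
  moreover have "\<exists>y. y \<in> c" if "c \<in> C" for c
    using that C orbit_self[OF X] by blast
  ultimately show ?thesis by (auto simp: image_iff)
qed

text \<open>A stable set contains the whole cycle of each of its points, so it is the union of its
  cycles and is recovered from them.\<close>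

lemma bij_betw_Union_stable:
  assumes X: "finite X" "p permutes X" and T: "p ` T = T"
  shows "bij_betw \<Union> (Pow (orbit p ` T)) {S. S \<subseteq> T \<and> p ` S = S}"
proof (rule bij_betw_byWitness[where f' = "\<lambda>S. orbit p ` S"])
  note self = orbit_self[OF X] and eq = orbit_eq[OF X]
  have Un: "\<Union> (orbit p ` S) = S" if "p ` S \<subseteq> S" for S
    using orbit_stable_subset[OF that] self by blast
  show "\<forall>C\<in>Pow (orbit p ` T). orbit p ` \<Union> C = C"
    using image_orbit_Union[OF X] by simp
  show "\<forall>S\<in>{S. S \<subseteq> T \<and> p ` S = S}. \<Union> (orbit p ` S) = S"
    using Un by simp
  show "\<Union> ` Pow (orbit p ` T) \<subseteq> {S. S \<subseteq> T \<and> p ` S = S}"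
  proof safe
    fix C y c assume C: "C \<subseteq> orbit p ` T" "y \<in> c" "c \<in> C"
    then show "y \<in> T" using orbit_stable_subset[of p T] T by blast
  next
    fix C y c assume C: "C \<subseteq> orbit p ` T" "y \<in> c" "c \<in> C"
    then have "p y \<in> c" by (auto intro: orbit.step)
    then show "p y \<in> \<Union> C" using C by blast
  next
    fix C y c assume C: "C \<subseteq> orbit p ` T" "y \<in> c" "c \<in> C"
    then obtain x where x: "c = orbit p x" by blast
    have "orbit p (inv p y) = orbit p y"
      using permutation_orbit_step[of p "inv p y"] X
      by (simp add: permutes_imp_permutation permutes_inverses)
    then have "inv p y \<in> c" using self eq C x by metis
    then have "inv p y \<in> \<Union> C" using C by blast
    then show "y \<in> p ` \<Union> C" using X by (metis image_eqI permutes_inverses(1))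
  qed
  show "(`) (orbit p) ` {S. S \<subseteq> T \<and> p ` S = S} \<subseteq> Pow (orbit p ` T)" by blast
qed

text \<open>Cycles are disjoint, so a union of cycles has as its size the sum of their
  lengths.\<close>

lemma sum_stable_subsets:
  assumes X: "finite X" "p permutes X" and T: "T \<subseteq> X" "p ` T = T"
  shows "(\<Sum>S | S \<subseteq> T \<and> p ` S = S. f (cycle_count p S) (card S))
       = (\<Sum>C\<in>Pow (orbit p ` T). f (card C) (sum card C))"
proof -
  note bij = bij_betw_Union_stable[OF X T(2)]
  have "(\<Sum>S | S \<subseteq> T \<and> p ` S = S. f (cycle_count p S) (card S))
     = (\<Sum>C\<in>Pow (orbit p ` T). f (cycle_count p (\<Union> C)) (card (\<Union> C)))"
    by (rule sum.reindex_bij_betw[OF bij, symmetric])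
  also have "\<dots> = (\<Sum>C\<in>Pow (orbit p ` T). f (card C) (sum card C))"
  proof (intro sum.cong refl)
    fix C assume C: "C \<in> Pow (orbit p ` T)"
    have orb: "orbit p y = c" if "c \<in> C" "y \<in> c" for c y
      using that C orbit_eq[OF X] by blast
    have "orbit p ` \<Union> C = C"
      using image_orbit_Union[OF X] C by simp
    moreover have "card (\<Union> C) = sum card C"
    proof (rule card_Union_disjoint)
      show "pairwise disjnt C"
        using orb by (metis disjnt_iff pairwiseI)
      show "finite c" if "c \<in> C" for c
        using that C finite_orbit[OF orbit_self[OF X]] by blast
    qed
    ultimately show "f (cycle_count p (\<Union> C)) (card (\<Union> C)) = f (card C) (sum card C)"
      by (simp add: cycle_count_def)
  qed
  finally show ?thesis .
qed

lemma sum_Pow_insert: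
  assumes "finite A" "a \<notin> A"
  shows "(\<Sum>C\<in>Pow (insert a A). f C) = (\<Sum>C\<in>Pow A. f C) + (\<Sum>C\<in>Pow A. f (insert a C))"
proof -
  have "inj_on (insert a) (Pow A)" using assms by (auto simp: inj_on_def)
  moreover have "Pow A \<inter> insert a ` Pow A = {}" using assms by auto
  ultimately show ?thesis
    using assms by (simp add: Pow_insert sum.union_disjoint sum.reindex)
qed

lemma sum_neg_one_power_card_Pow:
  "finite A \<Longrightarrow> (\<Sum>C\<in>Pow A. (-1) ^ card C) = (if A = {} then 1 else 0 :: 'b :: comm_ring_1)"
proof (induction A rule: finite_induct)
  case (insert a A)
  have "(\<Sum>C\<in>Pow A. (-1) ^ card (insert a C)) = (\<Sum>C\<in>Pow A. - ((-1) ^ card C :: 'b))"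
    using insert.hyps by (intro sum.cong) (auto simp: card_insert_if finite_subset)
  then show ?case using insert.hyps by (simp add: sum_Pow_insert sum_negf)
qed simp

text \<open>
  Summing \<open>(-1)\<^sup>c\<close> over all unions of cycles avoiding \<open>x\<close> detects the permutations whose
  only cycle is the one through \<open>x\<close>.
\<close>

lemma sum_stable_eq_cyclic_indicator:
  assumes X: "finite X" "p permutes X" and x: "x \<in> X"
  shows "(\<Sum>S | S \<subseteq> X - {x} \<and> p ` S = S. (-1) ^ cycle_count p S)
       = (if cyclic_on p X then 1 else 0 :: 'b :: comm_ring_1)"
proof -
  let ?T = "X - orbit p x"
  note self = orbit_self[OF X] and eq = orbit_eq[OF X]
  have O: "p ` orbit p x = orbit p x"
  proof
    show "p ` orbit p x \<subseteq> orbit p x" by (auto intro: orbit.step)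
    then show "orbit p x \<subseteq> p ` orbit p x"
      using endo_inj_surj[of "orbit p x" p] finite_orbit[OF self] X
      by (metis inj_on_subset permutes_inj subset_UNIV equalityD2)
  qed
  have T: "p ` ?T = ?T"
    using O X by (metis image_set_diff permutes_image permutes_inj)
  \<comment> \<open>A stable set that avoids \<open>x\<close> avoids the entire cycle of
    \<open>x\<close>.\<close>
  have *: "S \<subseteq> X - {x} \<longleftrightarrow> S \<subseteq> ?T" if "p ` S = S" for S
  proof
    assume S: "S \<subseteq> X - {x}"
    show "S \<subseteq> ?T"
    proof
      fix y assume y: "y \<in> S"
      have "orbit p y \<subseteq> S" using that y by (intro orbit_stable_subset) auto
      then have "y \<notin> orbit p x" using S self[of x] eq by blast
      then show "y \<in> ?T" using y S by blast
    qed
  next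
    assume "S \<subseteq> ?T"
    then show "S \<subseteq> X - {x}" using self by blast
  qed
  have "(\<Sum>S | S \<subseteq> X - {x} \<and> p ` S = S. (-1) ^ cycle_count p S)
      = (\<Sum>S | S \<subseteq> ?T \<and> p ` S = S. (-1) ^ cycle_count p S :: 'b)"
    using * by (intro sum.cong) auto
  also have "\<dots> = (\<Sum>C\<in>Pow (orbit p ` ?T). (-1) ^ card C)"
    using sum_stable_subsets[OF X _ T, of "\<lambda>c _. (-1) ^ c"] by blast
  also have "\<dots> = (if ?T = {} then 1 else 0)"
    using X by (subst sum_neg_one_power_card_Pow) auto
  also have "?T = {} \<longleftrightarrow> cyclic_on p X"
  proof
    assume "?T = {}"
    then show "cyclic_on p X"
      using permutes_orbit_subset[OF X(2) x] x by (intro cyclic_on_singleI[of x]) auto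
  next
    assume "cyclic_on p X"
    then show "?T = {}" using orbit_cyclic_eq3[OF _ x] by simp
  qed
  finally show ?thesis .
qed

text \<open>The sum expands the product of the operators 1 - E^(w c) over \<open>c \<in> A\<close>.
  Weight 1 gives \<open>1 - E\<close>, lowering \<open>N\<close>; weight 2 gives (1 - E)(1 + E),
  which also raises the first index. The bound on \<open>card A\<close> prevents truncation.\<close>

lemma sum_Pow_bsum:
  fixes w :: "'b \<Rightarrow> nat" and q :: real
  assumes "finite A" "card A \<le> N" "\<And>c. c \<in> A \<Longrightarrow> w c = 1 \<or> w c = 2"
  shows "(\<Sum>C\<in>Pow A. (-1) ^ card C * bsum 0 N (q - sum w C))
       = bsum (card {c\<in>A. w c = 2}) (N - card A) q"
  using assms
proof (induction A arbitrary: q rule: finite_induct)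
  case (insert a A)
  let ?b = "card {c\<in>A. w c = 2}"
  obtain N' where N': "N - card A = Suc N'"
    using insert by (metis Suc_diff_Suc Suc_le_lessD card_insert_disjoint)
  then have N'': "N - card (insert a A) = N'" using insert by simp
  have IH: "(\<Sum>C\<in>Pow A. (-1) ^ card C * bsum 0 N (q - sum w C)) = bsum ?b (Suc N') q" for q :: real
    using insert N' by simp
  have "(\<Sum>C\<in>Pow A. (-1) ^ card (insert a C) * bsum 0 N (q - sum w (insert a C)))
      = (\<Sum>C\<in>Pow A. - ((-1) ^ card C * bsum 0 N ((q - w a) - sum w C)))"
  proof (intro sum.cong refl)
    fix C assume "C \<in> Pow A"
    then have "finite C" "a \<notin> C" using insert.hyps by (auto intro: finite_subset)
    then show "(-1) ^ card (insert a C) * bsum 0 N (q - sum w (insert a C))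
        = - ((-1) ^ card C * bsum 0 N ((q - w a) - sum w C))"
      by (simp add: diff_diff_eq del: bsum.simps)
  qed
  then have *: "(\<Sum>C\<in>Pow (insert a A). (-1) ^ card C * bsum 0 N (q - sum w C))
      = bsum ?b (Suc N') q - bsum ?b (Suc N') (q - w a)"
    using insert.hyps by (simp add: sum_Pow_insert sum_negf IH del: bsum.simps of_nat_sum)
  show ?case
  proof (cases "w a = 1")
    case True
    then have "{c\<in>insert a A. w c = 2} = {c\<in>A. w c = 2}" by auto
    then show ?thesis using * True N'' bsum_diff[of ?b N' q] by (simp del: bsum.simps)
  next
    case False
    then have w: "w a = 2" using insert.prems by blast
    then have "{c\<in>insert a A. w c = 2} = insert a {c\<in>A. w c = 2}" by auto
    then have "card {c\<in>insert a A. w c = 2} = Suc ?b" using insert.hyps by simp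
    moreover have "bsum ?b (Suc N') q - bsum ?b (Suc N') (q - 2) = bsum (Suc ?b) N' q"
      using bsum_diff[of ?b N' q] bsum_diff[of ?b N' "q - 1"] by simp
    ultimately show ?thesis using * w N'' by (simp del: bsum.simps)
  qed
qed simp

section \<open>Cycles and stable sets of an involution\<close>

lemma orbit_involution:
  assumes "p \<circ> p = id"
  shows "orbit p x = {x, p x}"
proof
  have pp: "p (p y) = y" for y using assms by (metis comp_apply id_apply)
  show "orbit p x \<subseteq> {x, p x}"
    by (rule orbit_stable_subset) (auto simp: pp)
  show "{x, p x} \<subseteq> orbit p x"
    using orbit.base[of p x] orbit.step[of "p x" p x] by (auto simp: pp)
qed

lemma card_orbit_involution:
  assumes "p \<circ> p = id"
  shows "card (orbit p x) = 1 \<or> card (orbit p x) = 2"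
  unfolding orbit_involution[OF assms] by (cases "p x = x") auto

lemma card_orbits_involution:
  assumes X: "finite X" "p permutes X" and inv: "p \<circ> p = id" and T: "T \<subseteq> X" "p ` T = T"
  defines "k \<equiv> card {c \<in> orbit p ` T. card c = 2}"
  shows "card T = card {x\<in>T. p x = x} + 2 * k" "card (orbit p ` T) = card {x\<in>T. p x = x} + k"
proof -
  let ?O = "orbit p ` T" and ?F = "{x\<in>T. p x = x}"
  note orb = orbit_involution[OF inv]
  have fin: "finite T" "finite ?O" using X T by (auto intro: finite_subset)
  have w: "card c = 1 \<or> card c = 2" if "c \<in> ?O" for c
    using that card_orbit_involution[OF inv] by auto
  have "{c\<in>?O. card c = 1} = (\<lambda>x. {x}) ` ?F"
    by (auto simp: orb card_insert_if image_iff split: if_splits)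
  then have O1: "card {c\<in>?O. card c = 1} = card ?F"
    by (simp add: card_image)
  have split: "?O = {c\<in>?O. card c = 1} \<union> {c\<in>?O. card c = 2}" using w by blast
  have "card T = card (\<Union> ?O)"
    using orbit_stable_subset[of p T] T orbit_self[OF X] by (intro arg_cong[of _ _ card]) blast
  also have "\<dots> = sum card ?O"
  proof (rule card_Union_disjoint)
    show "pairwise disjnt ?O"
      using orbit_eq[OF X] by (auto simp: pairwise_def disjnt_iff) blast+
    show "finite c" if "c \<in> ?O" for c using that orb by auto
  qed
  also have "\<dots> = sum card {c\<in>?O. card c = 1} + sum card {c\<in>?O. card c = 2}"
    using fin by (subst split, intro sum.union_disjoint) auto
  also have "\<dots> = card {c\<in>?O. card c = 1} + 2 * k" by (simp add: k_def)
  finally show "card T = card ?F + 2 * k" using O1 by simp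
  have "card ?O = card {c\<in>?O. card c = 1} + card {c\<in>?O. card c = 2}"
    using fin by (subst split, intro card_Un_disjoint) auto
  then show "card ?O = card ?F + k" using O1 by (simp add: k_def)
qed

lemma sum_stable_bsum:
  fixes q :: real
  assumes X: "finite X" "p permutes X" and inv: "p \<circ> p = id"
    and T: "T \<subseteq> X" "p ` T = T" and k: "card T = card {x\<in>T. p x = x} + 2 * k"
    and N: "card {x\<in>T. p x = x} + k \<le> N"
  shows "(\<Sum>S | S \<subseteq> T \<and> p ` S = S. (-1) ^ cycle_count p S * bsum 0 N (q - card S))
       = bsum k (N - (card {x\<in>T. p x = x} + k)) q"
proof -
  let ?O = "orbit p ` T"
  have b: "card {c\<in>?O. card c = 2} = k" and O: "card ?O = card {x\<in>T. p x = x} + k"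
    using card_orbits_involution[OF X inv T] k by auto
  have w: "card c = 1 \<or> card c = 2" if "c \<in> ?O" for c
    using that card_orbit_involution[OF inv] by auto
  have "finite ?O" using X T by (auto intro: finite_subset)
  have "(\<Sum>S | S \<subseteq> T \<and> p ` S = S. (-1) ^ cycle_count p S * bsum 0 N (q - card S))
      = (\<Sum>C\<in>Pow ?O. (-1) ^ card C * bsum 0 N (q - sum card C))"
    by (rule sum_stable_subsets[OF X T])
  also have "\<dots> = bsum k (N - card ?O) q"
    using sum_Pow_bsum[of ?O N card q] \<open>finite ?O\<close> N O w b by simp
  finally show ?thesis using O by simp
qed

text \<open>A permutation stabilising \<open>S\<close> is a unique pair of permutations of
  \<open>S\<close> and of its complement, and its cycles split accordingly.\<close>

lemma sum_stabilizer_power_cycle_count: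
  fixes u v :: "'b :: comm_ring_1"
  assumes X: "finite X" and S: "S \<subseteq> X"
  shows "(\<Sum>r | r permutes X \<and> r ` S = S. u ^ cycle_count r S * v ^ cycle_count r (X - S))
       = pochhammer u (card S) * pochhammer v (card (X - S))"
proof -
  have fin: "finite S" "finite (X - S)" using assms finite_subset by auto
  have "pochhammer u (card S) * pochhammer v (card (X - S))
     = (\<Sum>a | a permutes S. u ^ cycle_count a S)
         * (\<Sum>b | b permutes X - S. v ^ cycle_count b (X - S))"
    using fin by (simp add: sum_power_cycle_count)
  also have "\<dots> = (\<Sum>(a, b)\<in>{a. a permutes S} \<times> {b. b permutes X - S}.
        u ^ cycle_count a S * v ^ cycle_count b (X - S))"
    by (simp add: sum_product sum.cartesian_product)
  also have "\<dots> = (\<Sum>r | r permutes X \<and> r ` S = S. u ^ cycle_count r S * v ^ cycle_count r (X - S))"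
  proof (rule sum.reindex_bij_witness[of _ "\<lambda>r. (restrict_id r S, restrict_id r (X - S))" "\<lambda>(a,
      b). a \<circ> b"], goal_cases)
    case (1 z)
    obtain a b where z: "z = (a, b)" and a: "a permutes S" and b: "b permutes X - S"
      using 1 by auto
    have bx: "b x \<in> X - S \<longleftrightarrow> x \<in> X - S" for x using b by (rule permutes_in_image)
    have bx': "b x \<notin> S" if "x \<in> X" "x \<notin> S" for x using bx[of x] that by blast
    have "restrict_id (a \<circ> b) S = a"
      using a b by (auto simp: restrict_id_def fun_eq_iff permutes_not_in)
    moreover have "restrict_id (a \<circ> b) (X - S) = b"
      using a b bx' by (auto simp: restrict_id_def fun_eq_iff permutes_not_in)
    ultimately show ?case using z by simp
  next
    case (2 z)
    obtain a b where z: "z = (a, b)" and a: "a permutes S" and b: "b permutes X - S"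
      using 2 by auto
    have "a \<circ> b permutes X"
      using a b S by (intro permutes_compose) (auto intro: permutes_subset)
    moreover have "(a \<circ> b) ` S = a ` S"
      using b by (auto simp: permutes_not_in image_iff)
    ultimately show ?case using z a by (simp add: permutes_image)
  next
    case (3 r)
    then have r: "r permutes X" "r ` S = S" by auto
    have rx: "r x \<in> S \<longleftrightarrow> x \<in> S" for x
      using r by (metis image_iff inj_eq permutes_inj)
    show ?case
      using r rx by (auto simp: restrict_id_def fun_eq_iff permutes_not_in permutes_in_image)
  next
    case (4 r)
    then have r: "r permutes X" "r ` S = S" by auto
    then have "r ` (X - S) = X - S"
      by (metis image_set_diff permutes_image permutes_inj)
    with r show ?case by (auto intro!: permutes_restrict_id bij_betw_stable)
  next
    case (5 z)
    obtain a b where z: "z = (a, b)" and a: "a permutes S" and b: "b permutes X - S"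
      using 5 by auto
    have bx: "b x \<in> X - S \<longleftrightarrow> x \<in> X - S" for x using b by (rule permutes_in_image)
    have bx': "b x \<notin> S" if "x \<in> X" "x \<notin> S" for x using bx[of x] that by blast
    have "cycle_count a S = cycle_count (a \<circ> b) S"
      using a b by (intro cycle_count_cong) (auto simp: permutes_not_in permutes_in_image)
    moreover have "cycle_count b (X - S) = cycle_count (a \<circ> b) (X - S)"
      using a b bx bx' by (intro cycle_count_cong) (auto simp: permutes_not_in permutes_in_image)
    ultimately show ?case using z by simp
  qed
  finally show ?thesis by simp
qed

section \<open>Products of full cycles with an involution\<close>

text \<open>By the parity rule the sign splits into a constant depending on \<open>a\<close> and the
  sign \<open>(-1) ^ cycle_count r S\<close>, which turns the weight \<open>q\<close> of each cycle
  inside \<open>S\<close> into \<open>- q\<close>.\<close>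

lemma sum_stabilizer_signed:
  fixes q :: real
  assumes X: "finite X" and S: "S \<subseteq> X" and a: "bij_betw a S S"
  shows "(\<Sum>r | r permutes X \<and> r ` S = S. (-1) ^ cycle_count (a \<circ> r) S * q ^ cycle_count r X)
       = (-1) ^ (card S + cycle_count a S) * (pochhammer (- q) (card S)
           * pochhammer q (card (X - S)))"
proof -
  have fin: "finite S" "finite (X - S)" using assms finite_subset by auto
  have "(\<Sum>r | r permutes X \<and> r ` S = S. (-1) ^ cycle_count (a \<circ> r) S * q ^ cycle_count r X)
      = (\<Sum>r | r permutes X \<and> r ` S = S. (-1) ^ (card S + cycle_count a S)
          * ((- q) ^ cycle_count r S * q ^ cycle_count r (X - S)))"
  proof (intro sum.cong refl, clarify)
    fix r assume r: "r permutes X" "r ` S = S"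
    then have "r ` (X - S) = X - S"
      by (metis image_set_diff permutes_image permutes_inj)
    then have "cycle_count r (S \<union> (X - S)) = cycle_count r S + cycle_count r (X - S)"
      using fin r by (intro cycle_count_Un) auto
    moreover have "S \<union> (X - S) = X" using S by blast
    ultimately have c: "cycle_count r X = cycle_count r S + cycle_count r (X - S)" by simp
    have "(-1 :: real) ^ cycle_count (a \<circ> r) S
        = (-1) ^ (card S + cycle_count a S + cycle_count r S)"
      using fin a bij_betw_stable[OF r] by (intro neg_one_power_cycle_count_comp)
    then show "(-1) ^ cycle_count (a \<circ> r) S * q ^ cycle_count r X
        = (-1) ^ (card S + cycle_count a S)
          * ((- q) ^ cycle_count r S * q ^ cycle_count r (X - S))"
      unfolding c power_minus[of q] by (simp add: power_add)
  qed
  then show ?thesis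
    by (simp add: sum_distrib_left[symmetric] sum_stabilizer_power_cycle_count[OF X S])
qed

text \<open>Up to sign the first symbol is the falling factorial of \<open>q\<close>, whose top
  factor is \<open>q\<close>; the second rises from \<open>q\<close>. Setting one \<open>q\<close>
  aside leaves a single run of \<open>n - 1\<close> consecutive factors starting at
  \<open>q - s + 1\<close>.\<close>

lemma pochhammer_minus_mult:
  fixes q :: real
  assumes "s \<le> n" "n \<ge> 1"
  shows "(-1) ^ s * (pochhammer (- q) s * pochhammer q (n - s))
      = q * (fact (n - 1) * bsum 0 (n - 1) (q + 1 - s))"
proof (cases s)
  case 0
  with assms show ?thesis using pochhammer_rec[of q "n - 1"] by simp
next
  case (Suc t)
  have "(-1) ^ s * pochhammer (- q) s = pochhammer (q - s + 1) s"
    using pochhammer_minus[of q s] by (simp add: power_mult_distrib[symmetric]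
        mult.assoc[symmetric])
  also have "\<dots> = pochhammer (q - s + 1) t * q"
    by (simp add: Suc pochhammer_Suc)
  finally have minus: "(-1) ^ s * pochhammer (- q) s = pochhammer (q - s + 1) t * q" .
  have "q - s + 1 + t = q" by (simp add: Suc)
  then have "(-1) ^ s * (pochhammer (- q) s * pochhammer q (n - s))
      = q * (pochhammer (q - s + 1) t * pochhammer (q - s + 1 + t) (n - s))"
    by (simp only: mult.assoc[symmetric] minus) (simp only: mult_ac)
  also have "\<dots> = q * pochhammer (q - s + 1) (t + (n - s))"
    by (simp add: pochhammer_product')
  also have "t + (n - s) = n - 1" using assms Suc by simp
  finally show ?thesis by (simp add: algebra_simps)
qed

section \<open>The contribution of a single subset, for a fixed involution\<close>

context
  fixes X :: "'a set" and \<pi> :: "'a \<Rightarrow> 'a" and q :: real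
  assumes fin: "finite X" and ne: "X \<noteq> {}" and perm: "\<pi> permutes X" and inv: "\<pi> \<circ> \<pi> = id"
begin

text \<open>The contribution of \<open>S\<close> after substituting
  \<open>\<zeta> = \<pi> \<circ> \<sigma>\<close>: stability of \<open>S\<close> under
  \<open>\<zeta>\<close> becomes \<open>\<sigma>\<close> S = \<pi> \<open>S\<close> because
  \<open>\<pi>\<close> is an involution.\<close>

definition signed_count :: "'a set \<Rightarrow> real" where
  "signed_count S = (\<Sum>\<sigma> | \<sigma> permutes X \<and> \<sigma> ` S
      = \<pi> ` S. (-1) ^ cycle_count (\<pi> \<circ> \<sigma>) S * q ^ cycle_count \<sigma> X)"

lemma involution_apply: "\<pi> (\<pi> x) = x"
  using inv by (metis comp_apply id_apply)

lemma card_ge_1: "card X \<ge> 1"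
  using fin ne by (simp add: Suc_le_eq card_gt_0_iff)

lemma signed_count_stable:
  assumes S: "S \<subseteq> X" "\<pi> ` S = S"
  shows "signed_count S = (-1) ^ cycle_count \<pi> S * (q * (fact (card X - 1)
      * bsum 0 (card X - 1) (q + 1 - card S)))"
proof -
  have "card (X - S) = card X - card S" "card S \<le> card X"
    using fin S by (auto simp: card_Diff_subset finite_subset card_mono)
  then show ?thesis
    unfolding signed_count_def S(2)
    using sum_stabilizer_signed[OF fin S(1) bij_betw_stable[OF perm S(2)], of q]
      pochhammer_minus_mult[of "card S" "card X" q] card_ge_1
    by (simp add: power_add mult_ac del: bsum.simps)
qed

text \<open>Composing \<open>\<sigma>\<close> with the transposition of \<open>x\<close> and
  \<open>\<pi> x\<close> reduces to permutations stabilising \<open>insert x S\<close>. The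
  transposition costs one cycle, hence one factor \<open>q\<close>, and the extra fixed point
  \<open>x\<close> gives the minus sign.\<close>

lemma signed_count_almost_stable:
  assumes q: "q \<noteq> 0" and S: "S \<subseteq> X" "\<pi> ` S = S" and x: "x \<in> X" "\<pi> x \<noteq> x" "x \<notin> S"
  shows "signed_count (insert x S)
      = - ((-1) ^ cycle_count \<pi> S * (fact (card X - 1) * bsum 0 (card X - 1) (q - card S)))"
proof -
  let ?y = "\<pi> x" and ?S = "insert x S"
  let ?t = "transpose x ?y"
  have y: "?y \<in> X" "?y \<notin> S" 
    using x perm S involution_apply by (auto simp: permutes_in_image) (metis image_eqI)
  have t: "?t permutes X" using x y by (intro permutes_swap_id)
  have tS: "?t z = z" if "z \<in> S" for z using that x y by (auto simp: transpose_def)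
  have piS: "\<pi> z \<in> S" if "z \<in> S" for z using S that by blast
  have img: "\<pi> ` ?S = insert ?y S" using S by simp
  have t1: "?t ` insert ?y S = ?S" using tS by (auto simp: image_iff)
  have t2: "?t ` ?S = insert ?y S" using tS by (auto simp: image_iff)
  have finS: "finite S" using fin S finite_subset by blast
  \<comment> \<open>The transposition sends \<open>x\<close> to \<open>\<pi> x\<close> and
    \<open>\<pi>\<close> sends it back, so \<open>x\<close> becomes fixed while \<open>S\<close>
    still sees \<open>\<pi>\<close>.\<close>
  have at: "(\<pi> \<circ> ?t) z = (if z = x then x else \<pi> z)" if "z \<in> ?S" for z
    using that tS involution_apply by auto
  have a: "bij_betw (\<pi> \<circ> ?t) ?S ?S"
  proof (rule bij_betw_stable)
    show "\<pi> \<circ> ?t permutes X" using t perm by (rule permutes_compose)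
    show "(\<pi> \<circ> ?t) ` ?S = ?S"
      unfolding image_comp[symmetric] t2 using S involution_apply by simp
  qed
  have "cycle_count (\<pi> \<circ> ?t) ({x} \<union> S) = cycle_count (\<pi> \<circ> ?t) {x} + cycle_count (\<pi> \<circ> ?t) S"
    using finS x at piS involution_apply by (intro cycle_count_Un) (auto simp: image_subset_iff)
  also have "cycle_count (\<pi> \<circ> ?t) {x} = 1" by (simp add: cycle_count_def)
  also have "cycle_count (\<pi> \<circ> ?t) S = cycle_count \<pi> S"
    using piS tS by (intro cycle_count_cong) auto
  finally have ca: "cycle_count (\<pi> \<circ> ?t) ?S = Suc (cycle_count \<pi> S)"
    by (simp only: insert_is_Un[symmetric] plus_1_eq_Suc)
  have "signed_count ?S = (\<Sum>r | r permutes X \<and> r ` ?S = ?S.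
      (-1) ^ cycle_count (\<pi> \<circ> ?t \<circ> r) ?S * q ^ cycle_count (?t \<circ> r) X)"
    unfolding signed_count_def
  proof (rule sum.reindex_bij_witness[of _ "\<lambda>r. ?t \<circ> r" "\<lambda>r. ?t \<circ> r"], goal_cases)
    case (2 r)
    then have "(?t \<circ> r) ` ?S = ?S" using img t1 by (metis (mono_tags) image_comp mem_Collect_eq)
    with 2 t show ?case by (auto intro: permutes_compose)
  next
    case (4 r)
    then have "(?t \<circ> r) ` ?S = \<pi> ` ?S" using img t2 by (metis (mono_tags) image_comp mem_Collect_eq)
    with 4 t show ?case by (auto intro: permutes_compose)
  qed (auto simp: o_assoc[symmetric], auto simp: o_assoc)
  \<comment> \<open>A permutation \<open>r\<close> stabilising \<open>insert x S\<close> has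
    \<open>x\<close> and \<open>\<pi> x\<close> in different cycles, so composing with the
    transposition merges them; the factor \<open>q\<close> restores the lost cycle and is cancelled
    at the end, where \<open>q \<noteq> 0\<close> enters.\<close>
  then have "q * signed_count ?S = (\<Sum>r | r permutes X \<and> r ` ?S = ?S.
      (-1) ^ cycle_count (\<pi> \<circ> ?t \<circ> r) ?S * (q * q ^ cycle_count (?t \<circ> r) X))"
    by (simp add: sum_distrib_left mult_ac)
  also have "\<dots> = (\<Sum>r | r permutes X \<and> r ` ?S = ?S.
      (-1) ^ cycle_count (\<pi> \<circ> ?t \<circ> r) ?S * q ^ cycle_count r X)"
  proof (intro sum.cong refl, clarify)
    fix r assume r: "r permutes X" "r ` ?S = ?S"
    have "orbit r x \<subseteq> ?S" using r by (intro orbit_stable_subset) auto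
    then have "?y \<notin> orbit r x" using x y by auto
    then have "Suc (cycle_count (?t \<circ> r) X) = cycle_count r X"
      using fin r x y by (intro cycle_count_transpose_comp)
    then show "(-1) ^ cycle_count (\<pi> \<circ> ?t \<circ> r) ?S * (q * q ^ cycle_count (?t \<circ> r) X)
        = (-1) ^ cycle_count (\<pi> \<circ> ?t \<circ> r) ?S * q ^ cycle_count r X"
      by (metis power_Suc)
  qed
  also have "\<dots> = (-1) ^ (card ?S + Suc (cycle_count \<pi> S)) * (pochhammer (- q) (card ?S)
      * pochhammer q (card (X - ?S)))"
    using sum_stabilizer_signed[OF fin _ a, of q] S x ca by simp
  also have "card (X - ?S) = card X - card ?S"
    using fin S x finS by (intro card_Diff_subset) auto
  also have "(-1) ^ (card ?S + Suc (cycle_count \<pi> S)) * (pochhammer (- q) (card ?S)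
      * pochhammer q (card X - card ?S))
     = (-1) ^ Suc (cycle_count \<pi> S) * ((-1) ^ card ?S * (pochhammer (- q) (card ?S)
         * pochhammer q (card X - card ?S)))"
    by (simp only: power_add mult_ac)
  also have "\<dots> = (-1) ^ Suc (cycle_count \<pi> S) * (q * (fact (card X - 1) * bsum 0 (card X - 1) (q
      + 1 - card ?S)))"
    using fin S x card_ge_1 by (subst pochhammer_minus_mult) (auto intro: card_mono)
  also have "q + 1 - card ?S = q - card S" using finS x by simp
  finally have "q * signed_count ?S
      = q * (- ((-1) ^ cycle_count \<pi> S * (fact (card X - 1) * bsum 0 (card X - 1) (q - card S))))"
    by (simp del: bsum.simps)
  then show ?thesis using q by (simp only: mult_cancel_left simp_thms)
qed

text \<open>Conjugation by the transposition of two elements of \<open>S - \<pi> ` S\<close> reverses the sign.\<close>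

lemma signed_count_eq_0:
  assumes S: "S \<subseteq> X" and xy: "x \<in> S" "y \<in> S" "\<pi> x \<notin> S" "\<pi> y \<notin> S" "x \<noteq> y"
  shows "signed_count S = 0"
proof -
  let ?t = "transpose x y"
  have t: "?t permutes X" using xy S by (intro permutes_swap_id) auto
  have finS: "finite S" using fin S finite_subset by blast
  have tS: "bij_betw ?t S S"
    using xy by (intro permutes_imp_bij permutes_swap_id)
  have notin: "x \<notin> \<pi> ` S" "y \<notin> \<pi> ` S" using xy involution_apply by auto
  then have tpi: "?t ` \<pi> ` S = \<pi> ` S"
    by (force simp: image_iff transpose_def)
  \<comment> \<open>A transposition is odd: this parity is the source of the sign reversal.\<close>
  have ct: "cycle_count ?t S + 1 = card S"
  proof -
    have "orbit id x = {x}" for x :: 'a by (simp add: orbit_eq_singleton_iff)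
    then have "cycle_count id S = card S" "y \<notin> orbit id x"
      using xy by (auto simp: cycle_count_def card_image)
    then show ?thesis
      using cycle_count_comp_transpose[OF finS permutes_id, of x y] xy by simp
  qed
  have flip: "(-1) ^ cycle_count (\<pi> \<circ> (?t \<circ> \<sigma> \<circ> ?t)) S * q ^ cycle_count (?t \<circ> \<sigma> \<circ> ?t) X
     = - ((-1) ^ cycle_count (\<pi> \<circ> \<sigma>) S * q ^ cycle_count \<sigma> X)"
    if s: "\<sigma> permutes X" "\<sigma> ` S = \<pi> ` S" for \<sigma>
  proof -
    have "cycle_count (?t \<circ> \<sigma> \<circ> ?t) X = cycle_count \<sigma> X"
      using cycle_count_conjugate[OF fin s(1) t] by simp
    moreover have "cycle_count (\<pi> \<circ> (?t \<circ> \<sigma> \<circ> ?t)) S = cycle_count (\<pi> \<circ> \<sigma> \<circ> ?t) S"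
    proof (rule cycle_count_cong[symmetric])
      show "(\<pi> \<circ> \<sigma> \<circ> ?t) ` S \<subseteq> S"
        unfolding image_comp[symmetric] bij_betw_imp_surj_on[OF tS] s using involution_apply by auto
      fix z assume "z \<in> S"
      then have "?t z \<in> S" using tS by (auto simp: bij_betw_def)
      then have "\<sigma> (?t z) \<in> \<pi> ` S" using s by blast
      then have "?t (\<sigma> (?t z)) = \<sigma> (?t z)" using notin by (metis transpose_apply_other)
      then show "(\<pi> \<circ> \<sigma> \<circ> ?t) z = (\<pi> \<circ> (?t \<circ> \<sigma> \<circ> ?t)) z" by simp
    qed
    moreover have "(-1 :: real) ^ cycle_count (\<pi> \<circ> \<sigma> \<circ> ?t) S
        = (-1) ^ (card S + cycle_count (\<pi> \<circ> \<sigma>) S + cycle_count ?t S)"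
    proof (rule neg_one_power_cycle_count_comp[OF finS _ tS])
      have "(\<pi> \<circ> \<sigma>) ` S = S"
        unfolding image_comp[symmetric] s using involution_apply by (auto simp: image_iff)
      then show "bij_betw (\<pi> \<circ> \<sigma>) S S"
        using s perm by (intro bij_betw_stable[of _ X]) (auto intro: permutes_compose)
    qed
    ultimately show ?thesis
      by (simp add: power_add ct[symmetric])
  qed
  have tt: "?t \<circ> (?t \<circ> \<sigma> \<circ> ?t) \<circ> ?t = \<sigma>" for \<sigma> :: "'a \<Rightarrow> 'a"
    by (simp add: fun_eq_iff)
  have "signed_count S = (\<Sum>\<sigma> | \<sigma> permutes X \<and> \<sigma> ` S = \<pi> ` S.
      (-1) ^ cycle_count (\<pi> \<circ> (?t \<circ> \<sigma> \<circ> ?t)) S * q ^ cycle_count (?t \<circ> \<sigma> \<circ> ?t) X)"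
    unfolding signed_count_def
  proof (rule sum.reindex_bij_witness[of _ "\<lambda>\<sigma>. ?t \<circ> \<sigma> \<circ> ?t" "\<lambda>\<sigma>. ?t \<circ> \<sigma> \<circ> ?t"], goal_cases)
    case (2 \<sigma>)
    then have "(?t \<circ> \<sigma> \<circ> ?t) ` S = \<pi> ` S"
      using bij_betw_imp_surj_on[OF tS] tpi by (simp only: image_comp[symmetric] mem_Collect_eq)
    with 2 t show ?case by (auto intro: permutes_compose)
  next
    case (4 \<sigma>)
    then have "(?t \<circ> \<sigma> \<circ> ?t) ` S = \<pi> ` S"
      using bij_betw_imp_surj_on[OF tS] tpi by (simp only: image_comp[symmetric] mem_Collect_eq)
    with 4 t show ?case by (auto intro: permutes_compose)
  qed (simp_all only: tt)
  also have "\<dots> = - signed_count S"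
    unfolding signed_count_def sum_negf[symmetric] using flip by (intro sum.cong) auto
  finally show ?thesis by simp
qed

section \<open>Summation over all subsets\<close>

lemma sum_cyclic_eq_signed_count:
  assumes x0: "x0 \<in> X"
  shows "(\<Sum>\<zeta> | \<zeta> permutes X \<and> cyclic_on \<zeta> X. q ^ cycle_count (\<pi> \<circ> \<zeta>) X)
       = (\<Sum>S\<in>Pow (X - {x0}). signed_count S)"
proof -
  let ?P = "{\<zeta>. \<zeta> permutes X}"
  have finP: "finite ?P" using fin by (rule finite_permutations)
  have "(\<Sum>\<zeta> | \<zeta> permutes X \<and> cyclic_on \<zeta> X. q ^ cycle_count (\<pi> \<circ> \<zeta>) X)
     = (\<Sum>\<zeta>\<in>{\<zeta>\<in>?P. cyclic_on \<zeta> X}. q ^ cycle_count (\<pi> \<circ> \<zeta>) X)" by simp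
  also have "\<dots> = (\<Sum>\<zeta>\<in>?P. (if cyclic_on \<zeta> X then 1 else 0) * q ^ cycle_count (\<pi> \<circ> \<zeta>) X)"
    using finP by (subst sum.inter_filter) (auto intro!: sum.cong)
  also have "\<dots> = (\<Sum>\<zeta>\<in>?P. \<Sum>S\<in>{S\<in>Pow (X - {x0}). \<zeta> ` S
      = S}. (-1) ^ cycle_count \<zeta> S * q ^ cycle_count (\<pi> \<circ> \<zeta>) X)"
    unfolding sum_distrib_right[symmetric]
    by (intro sum.cong refl) (simp add: sum_stable_eq_cyclic_indicator[OF fin _ x0, symmetric])
  also have "\<dots> = (\<Sum>S\<in>Pow (X - {x0}). \<Sum>\<zeta>\<in>{\<zeta>\<in>?P. \<zeta> ` S
      = S}. (-1) ^ cycle_count \<zeta> S * q ^ cycle_count (\<pi> \<circ> \<zeta>) X)"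
    using fin finP by (intro sum.swap_restrict) auto
  also have "\<dots> = (\<Sum>S\<in>Pow (X - {x0}). signed_count S)"
  proof (intro sum.cong refl)
    fix S :: "'a set"
    have img: "(\<pi> \<circ> r) ` S = \<pi> ` r ` S" for r :: "'a \<Rightarrow> 'a" by (simp add: image_comp)
    have invim: "\<pi> ` \<pi> ` A = A" for A using involution_apply by (auto simp: image_iff)
    have pp: "\<pi> \<circ> (\<pi> \<circ> r) = r" for r :: "'a \<Rightarrow> 'a" using inv by (simp add: o_assoc)
    \<comment> \<open>Composition with \<open>\<pi>\<close> on the left is its own inverse, so the
      same map serves in both directions.\<close>
    show "(\<Sum>\<zeta>\<in>{\<zeta>\<in>?P. \<zeta> ` S = S}. (-1) ^ cycle_count \<zeta> S * q ^ cycle_count (\<pi> \<circ> \<zeta>) X)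
        = signed_count S"
      unfolding signed_count_def
      by (rule sum.reindex_bij_witness[of _ "\<lambda>r. \<pi> \<circ> r" "\<lambda>r. \<pi> \<circ> r"])
        (auto simp: pp img invim perm intro!: permutes_compose simp del: comp_apply)
  qed
  finally show ?thesis .
qed

lemma sum_signed_count_stable:
  assumes T: "T \<subseteq> X" "\<pi> ` T = T" and k: "card T = card {x\<in>T. \<pi> x = x} + 2 * k"
    and N: "card {x\<in>T. \<pi> x = x} + k \<le> card X - 1"
  shows "(\<Sum>S | S \<subseteq> T \<and> \<pi> ` S = S. signed_count S)
    = q * (fact (card X - 1) * bsum k (card X - 1 - (card {x\<in>T. \<pi> x = x} + k)) (q + 1))"
proof -
  have "(\<Sum>S | S \<subseteq> T \<and> \<pi> ` S = S. signed_count S) = (\<Sum>S | S \<subseteq> T \<and> \<pi> ` S = S.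
      (q * fact (card X - 1)) * ((-1) ^ cycle_count \<pi> S * bsum 0 (card X - 1) ((q + 1) - card S)))"
    using T by (intro sum.cong) (auto simp: signed_count_stable simp del: bsum.simps)
  then show ?thesis
    unfolding sum_distrib_left[symmetric] sum_stable_bsum[OF fin perm inv T k N] by simp
qed

lemma sum_signed_count_almost_stable:
  assumes q: "q \<noteq> 0" and x: "x \<in> X" "\<pi> x \<noteq> x" "x \<notin> T"
    and T: "T \<subseteq> X" "\<pi> ` T = T" and k: "card T = card {x\<in>T. \<pi> x = x} + 2 * k"
    and N: "card {x\<in>T. \<pi> x = x} + k \<le> card X - 1"
  shows "(\<Sum>S | S \<subseteq> T \<and> \<pi> ` S = S. signed_count (insert x S))
    = - (fact (card X - 1) * bsum k (card X - 1 - (card {x\<in>T. \<pi> x = x} + k)) q)"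
proof -
  have "(\<Sum>S | S \<subseteq> T \<and> \<pi> ` S = S. signed_count (insert x S)) = (\<Sum>S | S \<subseteq> T \<and> \<pi> ` S = S.
      (- fact (card X - 1)) * ((-1) ^ cycle_count \<pi> S * bsum 0 (card X - 1) (q - card S)))"
  proof (intro sum.cong refl, clarify)
    fix S assume S: "S \<subseteq> T" "\<pi> ` S = S"
    then have "S \<subseteq> X" "x \<notin> S" using T x by auto
    then show "signed_count (insert x S)
        = (- fact (card X - 1)) * ((-1) ^ cycle_count \<pi> S * bsum 0 (card X - 1) (q - card S))"
      using signed_count_almost_stable[OF q _ S(2) x(1,2)] by (simp del: bsum.simps)
  qed
  then show ?thesis
    unfolding sum_distrib_left[symmetric] sum_stable_bsum[OF fin perm inv T k N] by simp
qed

text \<open>A set can contribute only if at most one of its points \<open>x\<close> has its image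
  outside. With none it is stable; with one, removing \<open>x\<close> leaves a stable set. A stable
  set avoiding \<open>x0\<close> also avoids \<open>\<pi> x0\<close>.\<close>

lemma sum_signed_count_split:
  assumes x0: "x0 \<in> X"
  shows "(\<Sum>S\<in>Pow (X - {x0}). signed_count S)
     = (\<Sum>S | S \<subseteq> X - {x0, \<pi> x0} \<and> \<pi> ` S = S. signed_count S)
     + (\<Sum>x\<in>{x\<in>X. \<pi> x \<noteq> x \<and> x \<noteq> x0}.
          \<Sum>S | S \<subseteq> X - {x, \<pi> x, x0, \<pi> x0} \<and> \<pi> ` S = S. signed_count (insert x S))"
proof -
  let ?A = "{S. S \<subseteq> X - {x0, \<pi> x0} \<and> \<pi> ` S = S}"
  let ?N = "{x\<in>X. \<pi> x \<noteq> x \<and> x \<noteq> x0}"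
  let ?T = "\<lambda>x. {S. S \<subseteq> X - {x, \<pi> x, x0, \<pi> x0} \<and> \<pi> ` S = S}"
  let ?f = "\<lambda>(x, S). insert x S"
  let ?B = "?f ` Sigma ?N ?T"
  have stable: "\<pi> z \<in> S \<longleftrightarrow> z \<in> S" if "\<pi> ` S = S" for S z
    using that involution_apply by (metis image_eqI)
  \<comment> \<open>The added point is the only one whose image leaves the set, so it can be
    recovered; injectivity and disjointness below rest on this.\<close>
  have only: "z \<in> insert x S \<and> \<pi> z \<notin> insert x S \<longleftrightarrow> z = x" if "x \<in> ?N" "S \<in> ?T x" for x S z
    using that stable[of S] by auto
  have finT: "finite (?T x)" for x
    by (rule finite_subset[of _ "Pow X"]) (use fin in auto)
  have finA: "finite ?A" by (rule finite_subset[of _ "Pow X"]) (use fin in auto)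
  have finB: "finite ?B" using finT fin by (intro finite_imageI finite_SigmaI) auto
  have inj: "inj_on ?f (Sigma ?N ?T)"
  proof (rule inj_onI, clarify)
    fix x S y U
    assume *: "x \<in> X" "\<pi> x \<noteq> x" "x \<noteq> x0" "S \<subseteq> X - {x, \<pi> x, x0, \<pi> x0}" "\<pi> ` S = S"
      "y \<in> X" "\<pi> y \<noteq> y" "y \<noteq> x0" "U \<subseteq> X - {y, \<pi> y, x0, \<pi> x0}" "\<pi> ` U = U"
      "insert x S = insert y U"
    then have "x = y" using only[of x S x] only[of y U x] by auto
    moreover have "x \<notin> S" "y \<notin> U" using * by auto
    ultimately show "x = y \<and> S = U" using *(11) by (simp add: insert_ident)
  qed
  have disj: "?A \<inter> ?B = {}"
  proof -
    have "insert x S \<notin> ?A" if "x \<in> ?N" "S \<in> ?T x" for x S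
      using only[OF that, of x] stable[of "insert x S" x] by auto
    then show ?thesis by auto
  qed
  have "(\<Sum>S\<in>Pow (X - {x0}). signed_count S) = (\<Sum>S\<in>?A \<union> ?B. signed_count S)"
  proof (rule sum.mono_neutral_right)
    show "finite (Pow (X - {x0}))" using fin by simp
    show "?A \<union> ?B \<subseteq> Pow (X - {x0})" by auto
    show "\<forall>S\<in>Pow (X - {x0}) - (?A \<union> ?B). signed_count S = 0"
    proof
      fix S assume S: "S \<in> Pow (X - {x0}) - (?A \<union> ?B)"
      have "\<exists>x\<in>S. \<pi> x \<notin> S"
      proof (rule ccontr)
        assume "\<not> ?thesis"
        then have "\<pi> ` S \<subseteq> S" by blast
        then have st: "\<pi> ` S = S" using involution_apply
            by (metis image_eqI subsetD subsetI subset_antisym)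
        then have "\<pi> x0 \<notin> S" using stable[OF st, of x0] S by auto
        then have "S \<in> ?A" using S st by auto
        then show False using S by blast
      qed
      then obtain x where x: "x \<in> S" "\<pi> x \<notin> S" by blast
      have xX: "x \<in> X" "x \<noteq> x0" "S \<subseteq> X" using S x by auto
      show "signed_count S = 0"
      proof (cases "\<exists>y\<in>S. \<pi> y \<notin> S \<and> y \<noteq> x")
        case True
        then show ?thesis using signed_count_eq_0[of S x] x xX by blast
      next
        case False
        let ?U = "S - {x}"
        have "\<pi> y \<in> ?U" if "y \<in> ?U" for y
          using that False x involution_apply by (metis Diff_iff insertE insertI1 singletonD)
        then have "\<pi> ` ?U \<subseteq> ?U" by blast
        then have st: "\<pi> ` ?U = ?U" using involution_apply
            by (metis image_eqI subsetD subsetI subset_antisym)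
        have "x0 \<notin> ?U" "\<pi> x \<notin> ?U" using S x by auto
        then have "?U \<in> ?T x" using S st stable[OF st, of x0] by auto
        moreover have "x \<in> ?N" using x xX by auto
        ultimately have "insert x ?U \<in> ?B" by (auto intro!: image_eqI[of _ _ "(x, ?U)"])
        moreover have "insert x ?U = S" using x by blast
        ultimately show ?thesis using S by simp
      qed
    qed
  qed
  also have "\<dots> = (\<Sum>S\<in>?A. signed_count S) + (\<Sum>S\<in>?B. signed_count S)"
    using finA finB disj by (rule sum.union_disjoint)
  also have "(\<Sum>S\<in>?B. signed_count S) = (\<Sum>z\<in>Sigma ?N ?T. signed_count (?f z))"
    using inj by (simp add: sum.reindex)
  also have "\<dots> = (\<Sum>(x, S)\<in>Sigma ?N ?T. signed_count (insert x S))"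
    by (intro sum.cong) auto
  also have "\<dots> = (\<Sum>x\<in>?N. \<Sum>S\<in>?T x. signed_count (insert x S))"
    using fin finT by (subst sum.Sigma) auto
  finally show ?thesis .
qed

text \<open>The base point \<open>x0\<close> is free, so a fixed point is taken whenever there is
  one. Each remaining cycle lowers the second index of \<open>bsum\<close> from
  \<open>card X - 1\<close> by one, and each 2-cycle raises the first.\<close>

lemma sum_cyclic_power_cycle_count:
  assumes q: "q \<noteq> 0" and k: "card X = card {x\<in>X. \<pi> x = x} + 2 * k"
  shows "(\<Sum>\<zeta> | \<zeta> permutes X \<and> cyclic_on \<zeta> X. q ^ cycle_count (\<pi> \<circ> \<zeta>) X)
      = fact (card X - 1) * hz k q"
proof -
  let ?F = "{x\<in>X. \<pi> x = x}"
  have pX: "\<pi> x \<in> X \<longleftrightarrow> x \<in> X" for x using perm by (rule permutes_in_image)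
  have nonfix: "{x\<in>X. \<pi> x \<noteq> x} = X - ?F" by auto
  have card_nonfix: "card {x\<in>X. \<pi> x \<noteq> x} = 2 * k"
    unfolding nonfix using fin k by (subst card_Diff_subset) auto
  have pi_diff: "\<pi> ` (X - D) = X - D" if "\<And>x. x \<in> D \<longleftrightarrow> \<pi> x \<in> D" for D
  proof -
    have "\<pi> ` D = D" using that involution_apply by (auto simp: image_iff) metis
    then show ?thesis using perm by (metis image_set_diff permutes_image permutes_inj)
  qed
  show ?thesis
  proof (cases "?F = {}")
    case False
    then obtain x0 where x0: "x0 \<in> X" "\<pi> x0 = x0" by blast
    define m where "m = card ?F - 1"
    have m: "card ?F = Suc m"
      using False fin by (simp add: m_def card_gt_0_iff)
    have n: "card X - 1 = m + 2 * k" using m k by simp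
    have N1: "card X - Suc (m + k) = k" "card X - (m + k) = Suc k" using m k by simp_all
    have T: "\<pi> ` (X - {x0, \<pi> x0}) = X - {x0, \<pi> x0}"
      by (rule pi_diff) (use x0 involution_apply in auto)
    have "{x \<in> X - {x0, \<pi> x0}. \<pi> x = x} = ?F - {x0}" using x0 by auto
    then have F: "card {x \<in> X - {x0, \<pi> x0}. \<pi> x = x} = m" using m x0 fin by simp
    have "card (X - {x0, \<pi> x0}) = m + 2 * k" using x0 n fin by simp
    \<comment> \<open>There remain \<open>m\<close> fixed points and \<open>k\<close>
      transpositions, so the second index is (m + 2k) - (m + k) = k.\<close>
    then have A: "(\<Sum>S | S \<subseteq> X - {x0, \<pi> x0} \<and> \<pi> ` S = S. signed_count S)
        = q * (fact (card X - 1) * bsum k k (q + 1))"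
      using sum_signed_count_stable[OF _ T, of k] F n N1 by (simp del: bsum.simps)
    \<comment> \<open>Removing \<open>x\<close>, \<open>\<pi> x\<close> and \<open>x0\<close> leaves
      \<open>m\<close> fixed points and \<open>k - 1\<close> transpositions, so the second index is
      k + 1.\<close>
    have B: "(\<Sum>S | S \<subseteq> X - {x, \<pi> x, x0, \<pi> x0} \<and> \<pi> ` S = S. signed_count (insert x S))
        = - (fact (card X - 1) * bsum (k - 1) (k + 1) q)"
      if x: "x \<in> X" "\<pi> x \<noteq> x" for x
    proof -
      let ?T = "X - {x, \<pi> x, x0, \<pi> x0}"
      have k0: "k \<ge> 1" using card_nonfix x fin by (cases k) auto
      have T: "\<pi> ` ?T = ?T" by (rule pi_diff) (use x0 involution_apply in \<open>auto, metis+\<close>)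
      have "{y \<in> ?T. \<pi> y = y} = ?F - {x0}" using x x0 involution_apply by auto
      then have F: "card {y \<in> ?T. \<pi> y = y} = m" using m x0 fin by simp
      have "card ?T = card X - card {x, \<pi> x, x0}"
        using x0 x pX fin by (subst card_Diff_subset) auto
      also have "card {x, \<pi> x, x0} = 3" using x x0 involution_apply by (auto simp: card_insert_if)
      finally have "card ?T = m + 2 * (k - 1)" using n k0 by simp
      then show ?thesis
        using sum_signed_count_almost_stable[OF q x _ _ T, of "k - 1"] F n N1 k0
            by (simp del: bsum.simps)
    qed
    have N: "{x \<in> X. \<pi> x \<noteq> x \<and> x \<noteq> x0} = {x\<in>X. \<pi> x \<noteq> x}" using x0 by auto
    have "(\<Sum>\<zeta> | \<zeta> permutes X \<and> cyclic_on \<zeta> X. q ^ cycle_count (\<pi> \<circ> \<zeta>) X)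
        = q * (fact (card X - 1) * bsum k k (q + 1))
          + (\<Sum>x\<in>{x\<in>X. \<pi> x \<noteq> x}. - (fact (card X - 1) * bsum (k - 1) (k + 1) q))"
      unfolding sum_cyclic_eq_signed_count[OF x0(1)] sum_signed_count_split[OF x0(1)] A N
      by (intro arg_cong2[of _ _ _ _ "(+)"] sum.cong refl) (use B in auto)
    also have "\<dots> = fact (card X - 1) * (q * bsum k k (q + 1) - 2 * real k * bsum (k - 1) (k + 1) q)"
      by (simp add: card_nonfix algebra_simps del: bsum.simps)
    also have "\<dots> = fact (card X - 1) * hz k q" by (simp only: hz_fixed_point_case)
    finally show ?thesis .
  next
    case True
    obtain x0 where x0: "x0 \<in> X" using ne by blast
    have nf: "\<pi> x \<noteq> x" if "x \<in> X" for x using True that by blast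
    have F: "card {x\<in>X - D. \<pi> x = x} = 0" for D using nf by (auto intro: card_eq_0_iff[THEN iffD2])
    have "card ?F = 0" using True by (simp only: card.empty)
    then have n: "card X = 2 * k" using k by simp
    then have k1: "k \<ge> 1" using card_ge_1 by simp
    have T: "\<pi> ` (X - {x0, \<pi> x0}) = X - {x0, \<pi> x0}"
      by (rule pi_diff) (use involution_apply in \<open>auto, metis+\<close>)
    have cT: "card (X - {x0, \<pi> x0}) = 2 * (k - 1)"
    proof -
      have "card (X - {x0, \<pi> x0}) = card X - card {x0, \<pi> x0}"
        using x0 pX fin by (subst card_Diff_subset) auto
      moreover have "card {x0, \<pi> x0} = 2" using nf[OF x0] by auto
      ultimately show ?thesis using n by simp
    qed
    have N1: "card X - 1 - (0 + (k - 1)) = k" using n k1 by simp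
    have A: "(\<Sum>S | S \<subseteq> X - {x0, \<pi> x0} \<and> \<pi> ` S = S. signed_count S)
        = q * (fact (card X - 1) * bsum (k - 1) k (q + 1))"
      using sum_signed_count_stable[OF _ T, of "k - 1"] F[of "{x0, \<pi> x0}"] cT N1 n k1
          by (simp del: bsum.simps)
    \<comment> \<open>The point \<open>\<pi> x0\<close> is special: its transposition is that of
      \<open>x0\<close>, so only one transposition is removed.\<close>
    have B0: "(\<Sum>S | S \<subseteq> X - {\<pi> x0, \<pi> (\<pi> x0), x0, \<pi> x0} \<and> \<pi> ` S = S. signed_count (insert (\<pi> x0) S))
        = - (fact (card X - 1) * bsum (k - 1) k q)"
    proof -
      have "X - {\<pi> x0, \<pi> (\<pi> x0), x0, \<pi> x0} = X - {x0, \<pi> x0}" using involution_apply by auto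
      then show ?thesis
        using sum_signed_count_almost_stable[OF q _ _ _ _ T, of "\<pi> x0" "k - 1"] F[of "{x0, \<pi> x0}"]
            cT N1 n k1 x0 pX nf
        by (simp del: bsum.simps)
    qed
    \<comment> \<open>Two different transpositions are removed, and the second index is (2k - 1) -
      (k - 2) = k + 1.\<close>
    have B: "(\<Sum>S | S \<subseteq> X - {x, \<pi> x, x0, \<pi> x0} \<and> \<pi> ` S = S. signed_count (insert x S))
        = - (fact (card X - 1) * bsum (k - 2) (k + 1) q)"
      if x: "x \<in> X" "x \<noteq> x0" "x \<noteq> \<pi> x0" for x
    proof -
      let ?T = "X - {x, \<pi> x, x0, \<pi> x0}"
      have T: "\<pi> ` ?T = ?T" by (rule pi_diff) (use involution_apply in \<open>auto, metis+\<close>)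
      have c4: "card {x, \<pi> x, x0, \<pi> x0} = 4"
        using x nf[OF x0] nf[OF x(1)] involution_apply by (auto simp: card_insert_if) metis+
      moreover have "{x, \<pi> x, x0, \<pi> x0} \<subseteq> X" using x x0 pX by auto
      ultimately have "card X \<ge> 4" "card ?T = card X - 4"
        using fin by (metis card_mono, subst card_Diff_subset, auto)
      then have k2: "k \<ge> 2" and cT: "card ?T = 2 * (k - 2)" using n by auto
      have N1: "card X - 1 - (0 + (k - 2)) = k + 1" using n k2 by simp
      show ?thesis
        using sum_signed_count_almost_stable[OF q x(1) nf[OF x(1)] _ _ T, of "k - 2"] F[of "{x, \<pi>
            x, x0, \<pi> x0}"] cT N1 n k2
        by (simp del: bsum.simps)
    qed
    let ?R = "X - {x0, \<pi> x0}"
    have N: "{x \<in> X. \<pi> x \<noteq> x \<and> x \<noteq> x0} = insert (\<pi> x0) ?R" using x0 nf pX by auto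
    have "(\<Sum>\<zeta> | \<zeta> permutes X \<and> cyclic_on \<zeta> X. q ^ cycle_count (\<pi> \<circ> \<zeta>) X)
        = q * (fact (card X - 1) * bsum (k - 1) k (q + 1)) + (- (fact (card X - 1)
            * bsum (k - 1) k q)
          + (\<Sum>x\<in>?R. - (fact (card X - 1) * bsum (k - 2) (k + 1) q)))"
    proof -
      have "(\<Sum>x\<in>?R. \<Sum>S | S \<subseteq> X - {x, \<pi> x, x0, \<pi> x0} \<and> \<pi> ` S = S. signed_count (insert x S))
          = (\<Sum>x\<in>?R. - (fact (card X - 1) * bsum (k - 2) (k + 1) q))"
        using B by (intro sum.cong) auto
      then show ?thesis
        unfolding sum_cyclic_eq_signed_count[OF x0] sum_signed_count_split[OF x0] A N
        using fin B0 by (subst sum.insert) auto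
    qed
    also have "\<dots> = fact (card X - 1) * (q * bsum (k - 1) k (q + 1) - bsum (k - 1) k q - 2
        * (real k - 1) * bsum (k - 2) (k + 1) q)"
      using cT k1 by (simp add: of_nat_diff algebra_simps del: bsum.simps)
    also have "\<dots> = fact (card X - 1) * hz k q" by (simp only: hz_no_fixed_point_case[OF k1])
    finally show ?thesis .
  qed
qed

end

section \<open>Log-concavity\<close>

lemma num_cycles_eq: "num_cycles m p = cycle_count p {1..m}"
  by (simp add: num_cycles_def perm_cycles_def cycle_count_def)

text \<open>The two polynomials agree at every nonzero real, hence at infinitely many
  points.\<close>

lemma full_cycles_num_cycles_poly:
  assumes n: "n \<ge> 1" and perm: "\<pi> permutes {1..n}" and inv: "\<pi> \<circ> \<pi> = id"
    and k: "n = card {x\<in>{1..n}. \<pi> x = x} + 2 * k"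
  shows "(\<Sum>\<zeta>\<in>full_cycles n. monom (1::real) (num_cycles n (\<pi> \<circ> \<zeta>)))
       = (\<Sum>j\<le>k div 2. monom (fact (n - 1) * hz_coeff k j) (k + 1 - 2 * j))" (is "?Q = ?R")
proof -
  have "poly ?Q q = poly ?R q" if "q \<noteq> 0" for q
  proof -
    have "poly ?Q q = (\<Sum>\<zeta> | \<zeta> permutes {1..n} \<and> cyclic_on \<zeta> {1..n}. q ^ cycle_count (\<pi> \<circ> \<zeta>) {1..n})"
      by (simp add: poly_sum poly_monom num_cycles_eq full_cycles_def)
    also have "\<dots> = fact (n - 1) * hz k q"
      using sum_cyclic_power_cycle_count[of "{1..n}" \<pi> q k] n perm inv k that by simp
    also have "\<dots> = poly ?R q"
      using hz_eq_sum[of k "k div 2" q] by (simp add: poly_sum poly_monom sum_distrib_left mult_ac)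
    finally show ?thesis .
  qed
  then have "- {0} \<subseteq> {q. poly (?Q - ?R) q = 0}" by auto
  moreover have "infinite (- {0} :: real set)"
    using infinite_UNIV_char_0[where 'a = real]
        by (metis Compl_eq_Diff_UNIV finite.emptyI finite.insertI finite_Diff2)
  ultimately have "?Q - ?R = 0"
    using poly_roots_finite[of "?Q - ?R"] finite_subset by blast
  then show ?thesis by simp
qed

lemma coeff_IO_poly_involution:
  assumes n: "n \<ge> 1" and perm: "\<pi> permutes {1..n}" and inv: "\<pi> \<circ> \<pi> = id"
    and k: "n = card {x\<in>{1..n}. \<pi> x = x} + 2 * k"
  shows "real_of_int (coeff (IO_poly n \<pi>) i)
       = (if i \<le> k div 2 then fact (n - 1) * hz_coeff k (k div 2 - i) else 0)"
proof -
  let ?Q = "\<Sum>\<zeta>\<in>full_cycles n. monom (1::real) (num_cycles n (\<pi> \<circ> \<zeta>))"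
  have pos: "num_cycles n p \<ge> 1" for p
    using n by (simp add: num_cycles_def perm_cycles_def Suc_le_eq card_gt_0_iff)
  have "real_of_int (coeff (IO_poly n \<pi>) i)
      = (\<Sum>\<zeta>\<in>full_cycles n. if (num_cycles n (\<pi> \<circ> \<zeta>) - 1) div 2 = i then 1 else 0)"
    by (simp add: IO_poly_def coeff_sum of_int_sum if_distrib[of real_of_int] cong: if_cong)
  \<comment> \<open>The exponent of the IO-polynomial is \<open>i\<close> exactly for 2i + 1 or 2i +
    2 cycles; positivity of the cycle count excludes 0 cycles when \<open>i = 0\<close>.\<close>
  also have "\<dots> = coeff ?Q (2 * i + 1) + coeff ?Q (2 * i + 2)"
    unfolding coeff_sum sum.distrib[symmetric]
  proof (intro sum.cong refl)
    fix \<zeta>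
    show "(if (num_cycles n (\<pi> \<circ> \<zeta>) - 1) div 2 = i then 1 else 0)
        = coeff (monom (1::real) (num_cycles n (\<pi> \<circ> \<zeta>))) (2 * i + 1)
            + coeff (monom 1 (num_cycles n (\<pi> \<circ> \<zeta>))) (2 * i + 2)"
      using pos[of "\<pi> \<circ> \<zeta>"] by auto
  qed
  \<comment> \<open>The exponents \<open>k + 1 - 2 * j\<close> share one parity, so only one of the
    two coefficients can be nonzero; for either parity of \<open>k\<close> this forces
    \<open>i = k div 2 - j\<close>.\<close>
  also have "\<dots> = (\<Sum>j\<le>k div 2. if k div 2 - j = i then fact (n - 1) * hz_coeff k j else 0)"
    unfolding full_cycles_num_cycles_poly[OF n perm inv k] coeff_sum sum.distrib[symmetric]
    by (intro sum.cong refl) (auto simp: coeff_monom)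
  \<comment> \<open>For \<open>i > k div 2\<close> the truncated difference
    \<open>k div 2 - i\<close> is 0 and would select \<open>j = 0\<close>; the inner condition rules
    this out.\<close>
  also have "\<dots> = (\<Sum>j\<le>k div 2. if j
      = k div 2 - i then (if i \<le> k div 2 then fact (n - 1) * hz_coeff k j else 0) else 0)"
    by (intro sum.cong refl) auto
  also have "\<dots> = (if i \<le> k div 2 then fact (n - 1) * hz_coeff k (k div 2 - i) else 0)"
    by simp
  finally show ?thesis .
qed

text \<open>Up to the factor \<open>fact (n - 1)\<close> and zeros at the end, the coefficients are
  those of \<open>hz_coeff k\<close> in reverse order, and log-concavity is symmetric under
  reversal.\<close>

lemma log_concave_IO_poly_involution:
  assumes n: "n \<ge> 1" and perm: "\<pi> permutes {1..n}" and inv: "\<pi> \<circ> \<pi> = id"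
  shows "log_concave_poly (IO_poly n \<pi>)"
proof -
  obtain k where k: "n = card {x\<in>{1..n}. \<pi> x = x} + 2 * k"
    using card_orbits_involution(1)[OF _ perm inv subset_refl permutes_image[OF perm]] by auto
  define c where "c i = (if i \<le> k div 2 then fact (n - 1) * hz_coeff k (k div 2 - i) else 0)" for i
  have c: "real_of_int (coeff (IO_poly n \<pi>) i) = c i" for i
    unfolding c_def by (rule coeff_IO_poly_involution[OF n perm inv k])
  show ?thesis
    unfolding log_concave_poly_def
  proof (intro conjI allI impI)
    fix i
    have "0 \<le> c i" by (simp add: c_def hz_coeff_nonneg)
    then show "0 \<le> coeff (IO_poly n \<pi>) i" using c[of i] by linarith
  next
    fix i :: nat assume "i \<ge> 1"
    have "c (i - 1) * c (i + 1) \<le> (c i)\<^sup>2"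
    proof (cases "i + 1 \<le> k div 2")
      case True
      define j where "j = k div 2 - (i + 1)"
      have j: "k div 2 - i = Suc j" "k div 2 - (i - 1) = Suc (Suc j)"
        using True \<open>i \<ge> 1\<close> by (auto simp: j_def)
      have "(fact (n - 1))\<^sup>2 * (hz_coeff k (Suc (Suc j)) * hz_coeff k j)
          \<le> (fact (n - 1))\<^sup>2 * (hz_coeff k (Suc j))\<^sup>2"
        by (intro mult_left_mono hz_coeff_log_concave) simp
      then show ?thesis
        using True j by (simp add: c_def j_def power2_eq_square mult_ac)
    qed (simp add: c_def)
    then have "real_of_int (coeff (IO_poly n \<pi>) (i - 1) * coeff (IO_poly n \<pi>) (i + 1))
        \<le> real_of_int ((coeff (IO_poly n \<pi>) i)\<^sup>2)"
      by (simp add: c)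
    then show "coeff (IO_poly n \<pi>) (i - 1) * coeff (IO_poly n \<pi>) (i + 1)
        \<le> (coeff (IO_poly n \<pi>) i)\<^sup>2"
      by (simp only: of_int_le_iff)
  qed
qed

section \<open>Involutions and the partitions with parts 2 and 1\<close>

lemma cycle_type_involution:
  assumes perm: "\<pi> permutes {1..n}" and inv: "\<pi> \<circ> \<pi> = id"
    and k: "n = card {x\<in>{1..n}. \<pi> x = x} + 2 * k"
  shows "cycle_type n \<pi> = replicate_mset k 2 + replicate_mset (n - 2 * k) 1"
proof -
  let ?O = "orbit \<pi> ` {1..n}"
  let ?O1 = "{c\<in>?O. card c = 1}" and ?O2 = "{c\<in>?O. card c = 2}"
  have split: "?O = ?O2 \<union> ?O1" using card_orbit_involution[OF inv] by auto
  note counts = card_orbits_involution[OF finite_atLeastAtMost perm inv subset_refl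
      permutes_image[OF perm]]
  have c2: "card ?O2 = k" using counts(1) k by simp
  have "card ?O = card ?O2 + card ?O1"
    by (subst split, rule card_Un_disjoint) auto
  then have c1: "card ?O1 = n - 2 * k" using counts(2) c2 k by simp
  have "cycle_type n \<pi> = image_mset card (mset_set (?O2 \<union> ?O1))"
    unfolding cycle_type_def perm_cycles_def by (subst split) (rule refl)
  also have "\<dots> = image_mset card (mset_set ?O2) + image_mset card (mset_set ?O1)"
    by (subst mset_set_Union) auto
  also have "image_mset card (mset_set ?O2) = image_mset (\<lambda>_. 2) (mset_set ?O2)"
    by (intro image_mset_cong) auto
  also have "image_mset card (mset_set ?O1) = image_mset (\<lambda>_. 1) (mset_set ?O1)"
    by (intro image_mset_cong) auto
  finally show ?thesis using c1 c2 by (simp add: image_mset_const_eq)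
qed

text \<open>Existence makes the choice in \<open>IO_poly_type\<close> select a permutation of the
  required type.\<close>

lemma ex_involution_cycle_type:
  assumes "2 * k \<le> n"
  shows "\<exists>\<pi>. \<pi> permutes {1..n} \<and> cycle_type n \<pi> = replicate_mset k 2 + replicate_mset (n - 2 * k) 1"
proof -
  \<comment> \<open>This swaps 2i - 1 and 2i for i from 1 to \<open>k\<close> and fixes everything
    else.\<close>
  define \<pi> :: "nat \<Rightarrow> nat" where
    "\<pi> x = (if x \<in> {1..2 * k} then if odd x then x + 1 else x - 1 else x)" for x
  have range: "\<pi> x \<in> {1..2 * k} \<longleftrightarrow> x \<in> {1..2 * k}" for x
    unfolding \<pi>_def by (auto, presburger)
  have invol: "\<pi> (\<pi> x) = x" for x
    using range[of x] unfolding \<pi>_def by auto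
  have "\<pi> permutes {1..n}"
    unfolding permutes_def
  proof (intro conjI allI impI)
    fix x assume "x \<notin> {1..n}"
    then show "\<pi> x = x" using assms by (auto simp: \<pi>_def)
  next
    fix y show "\<exists>!x. \<pi> x = y" using invol by metis
  qed
  moreover have "{x\<in>{1..n}. \<pi> x = x} = {2 * k + 1..n}"
    by (auto simp: \<pi>_def split: if_splits)
  then have "n = card {x\<in>{1..n}. \<pi> x = x} + 2 * k" using assms by simp
  moreover have "\<pi> \<circ> \<pi> = id" using invol by (simp add: fun_eq_iff)
  ultimately show ?thesis using cycle_type_involution by blast
qed

lemma involution_of_cycle_type:
  assumes perm: "\<pi> permutes {1..n}"
    and type: "cycle_type n \<pi> = replicate_mset k 2 + replicate_mset (n - 2 * k) 1"
  shows "\<pi> \<circ> \<pi> = id"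
proof
  fix x
  show "(\<pi> \<circ> \<pi>) x = id x"
  proof (cases "x \<in> {1..n}")
    case True
    have "card (orbit \<pi> x) \<in># cycle_type n \<pi>"
      using True by (simp add: cycle_type_def perm_cycles_def)
    then have "card (orbit \<pi> x) \<le> 2"
      unfolding type by (auto split: if_splits)
    moreover have sub: "{x, \<pi> x, \<pi> (\<pi> x)} \<subseteq> orbit \<pi> x"
      using orbit_self[OF _ perm] by (auto intro: orbit.intros)
    ultimately have "card {x, \<pi> x, \<pi> (\<pi> x)} \<le> 2"
      using card_mono[OF finite_orbit[OF orbit_self[OF _ perm]] sub] by simp
    \<comment> \<open>Three successive points in a cycle of length at most 2 must coincide
      somewhere, and by injectivity each coincidence gives
      \<open>\<pi> (\<pi> x) = x\<close>.\<close>
    then have "\<pi> (\<pi> x) = x \<or> \<pi> x = x \<or> \<pi> (\<pi> x) = \<pi> x"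
      by (auto simp: card_insert_if split: if_splits)
    then show ?thesis using permutes_inj[OF perm] by (auto simp: inj_eq)
  qed (use perm in \<open>simp add: permutes_not_in\<close>)
qed

theorem theorem2p3:
  fixes n :: nat
  assumes "n \<ge> 1"
  shows "(\<forall>k. 2 * k \<le> n \<longrightarrow>
           log_concave_poly (IO_poly_type (replicate_mset k 2 + replicate_mset (n - 2 * k) 1)))
       \<and> (\<forall>\<pi>. \<pi> permutes {1..n} \<and> \<pi> \<circ> \<pi> = id \<longrightarrow> log_concave_poly (IO_poly n \<pi>))"
proof (intro conjI allI impI)
  fix k assume k: "2 * k \<le> n"
  let ?lam = "replicate_mset k 2 + replicate_mset (n - 2 * k) 1"
  define \<pi> where "\<pi> = (SOME \<pi>. \<pi> permutes {1..n} \<and> cycle_type n \<pi> = ?lam)"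
  have \<pi>: "\<pi> permutes {1..n}" "cycle_type n \<pi> = ?lam"
    using someI_ex[OF ex_involution_cycle_type[OF k]] unfolding \<pi>_def by auto
  have "sum_mset ?lam = n" using k by simp
  then have "IO_poly_type ?lam = IO_poly n \<pi>"
    unfolding IO_poly_type_def Let_def \<pi>_def by simp
  then show "log_concave_poly (IO_poly_type ?lam)"
    using log_concave_IO_poly_involution[OF assms \<pi>(1) involution_of_cycle_type[OF \<pi>]] by simp
next
  fix \<pi> assume "\<pi> permutes {1..n} \<and> \<pi> \<circ> \<pi> = id"
  then show "log_concave_poly (IO_poly n \<pi>)"
    using log_concave_IO_poly_involution[OF assms] by blast
qed

end
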